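(* Let $m\in\mathbb{N}$, let $G$ be a group of type $\mathrm{FP}_m$ and let $\chi:G\to\mathbb{R}$ be a non-zero character. Then $\chi\in\Sigma^m(G;\mathbb{Z})$ if and only if for all sufficiently large $k$ there exists a chain endomorphism of $\mathbb{Z}G$-complexes $\varphi_q:\mathrm{C}_q(\mathrm{VR}_k(G))\to \mathrm{C}_q(\mathrm{VR}_k(G))$, $q=0,\ldots,m$, extending the identity on $\mathbb{Z}$, with $v(\varphi_q(c))-v(c)>0$ for every non-zero $c\in \mathrm{C}_q(\mathrm{VR}_k(G))$ and $q=0,\ldots,m$.
   Context: Countable groups are regarded as metric spaces: a finitely generated group $G$ carries the word metric $d(g,h)=l(g^{-1}h)$ with respect to a finite generating set ($l$ the word length); a countable group that is not finitely generated carries the restriction of the word metric of a finitely generated group containing it; subsets carry the subspace metric. For a metric space $X$, $k\ge 0$, $q\ge 0$, put $\Delta^q_k(X)=\{(x_0,\ldots,x_q)\in X^{q+1}\mid d(x_i,x_j)\le k \text{ for all } i,j\}$. The Vietoris--Rips complex $\mathrm{VR}_k(X)$ is the simplicial set with $q$-simplices $\Delta^q_k(X)$ (faces omit an entry, degeneracies repeat an entry). Its simplicial chain complex is $\mathrm{C}_q(\mathrm{VR}_k(X))=\mathbb{Z}[\Delta^q_k(X)]$ with $\partial_q(x_0,\ldots,x_q)=\sum_{i=0}^q(-1)^i(x_0,\ldots,\widehat{x_i},\ldots,x_q)$. For $X=G$ this is a complex of free $\mathbb{Z}G$-modules via diagonal left multiplication, with augmentation $\epsilon:\mathrm{C}_0(\mathrm{VR}_k(G))=\mathbb{Z}[G]\to\mathbb{Z}$,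 $g\mapsto 1$. A chain endomorphism $\varphi$ extends the identity on $\mathbb{Z}$ if $\epsilon\circ\varphi_0=\epsilon$. A direct system $(A_k)_k$ of abelian groups is essentially trivial if for every $i$ there is $j\ge i$ such that $A_i\to A_j$ is zero. A metric space $X$ is of type $\mathrm{FP}_m$ if $(\tilde{\mathrm{H}}_q(\mathrm{VR}_k(X)))_k$ (reduced homology, maps induced by inclusion) is essentially trivial for each $q=0,\ldots,m-1$. The group $G$ is of type $\mathrm{FP}_m$ if $(G,d)$ is. A character is a homomorphism $\chi:G\to(\mathbb{R},+)$; $G_\chi=\{g\in G\mid\chi(g)\ge 0\}$. By definition $\chi\in\Sigma^m(G;\mathbb{Z})$ if and only if the metric space $(G_\chi,d)$ is of type $\mathrm{FP}_m$. The valuation $v$ is defined by $v(g_0,\ldots,g_q)=\min_i\chi(g_i)$ on simplices and $v\big(\sum_\sigma n_\sigma\sigma\big)=\min\{v(\sigma)\mid n_\sigma\ne 0\}$ on chains, with $v(0)=+\infty$. *)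

theory Defs
  imports Complex_Main "HOL-Library.Extended_Real" "HOL-Algebra.Elementary_Groups"
    "HOL-Algebra.Free_Abelian_Groups"
begin

section \<open>Countable groups as metric spaces\<close>

definition finite_generating_set :: "('a, 'b) monoid_scheme \<Rightarrow> 'a set \<Rightarrow> bool" where
  "finite_generating_set G S \<longleftrightarrow> finite S \<and> S \<subseteq> carrier G \<and> generate G S = carrier G"

definition finitely_generated_group :: "('a, 'b) monoid_scheme \<Rightarrow> bool" where
  "finitely_generated_group G \<longleftrightarrow> (\<exists>S. finite_generating_set G S)"

definition word_length :: "('a, 'b) monoid_scheme \<Rightarrow> 'a set \<Rightarrow> 'a \<Rightarrow> nat" where
  "word_length G S g =
     (LEAST n. \<exists>ws. length ws = n \<and> set ws \<subseteq> S \<union> m_inv G ` S \<and> foldr (mult G) ws \<one>\<^bsub>G\<^esub> = g)"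

definition word_metric :: "('a, 'b) monoid_scheme \<Rightarrow> 'a set \<Rightarrow> 'a \<Rightarrow> 'a \<Rightarrow> real" where
  "word_metric G S g h = real (word_length G S (inv\<^bsub>G\<^esub> g \<otimes>\<^bsub>G\<^esub> h))"

text \<open>
  The predicate \<open>group_metric G d\<close> says that \<open>d\<close> is one of the metrics which the convention for
  countable groups allows on \<open>G\<close>.  A finitely generated overgroup \<open>H\<close> is countable, hence
  isomorphic to a group on a set of natural numbers, so letting \<open>H\<close> range over \<open>nat monoid\<close> loses
  no metric; \<open>i\<close> is the inclusion.  Countability of \<open>G\<close> follows in both cases.  Values of \<open>d\<close>
  outside the carrier are irrelevant.
\<close>

definition group_metric :: "('a, 'b) monoid_scheme \<Rightarrow> ('a \<Rightarrow> 'a \<Rightarrow> real) \<Rightarrow> bool" where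
  "group_metric G d \<longleftrightarrow>
     (if finitely_generated_group G
      then \<exists>S. finite_generating_set G S \<and>
             (\<forall>g\<in>carrier G. \<forall>h\<in>carrier G. d g h = word_metric G S g h)
      else \<exists>(H :: nat monoid) S i. group H \<and> finite_generating_set H S \<and> i \<in> mon G H \<and>
             (\<forall>g\<in>carrier G. \<forall>h\<in>carrier G. d g h = word_metric H S (i g) (i h)))"


section \<open>Vietoris--Rips chains\<close>

text \<open>A \<open>q\<close>-simplex is a list of \<open>q + 1\<close> points.\<close>

definition vr_simplices :: "'a set \<Rightarrow> ('a \<Rightarrow> 'a \<Rightarrow> real) \<Rightarrow> real \<Rightarrow> nat \<Rightarrow> 'a list set" where
  "vr_simplices X d k q =
     {xs. length xs = Suc q \<and> set xs \<subseteq> X \<and> (\<forall>x\<in>set xs. \<forall>y\<in>set xs. d x y \<le> k)}"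

definition vr_chains :: "'a set \<Rightarrow> ('a \<Rightarrow> 'a \<Rightarrow> real) \<Rightarrow> real \<Rightarrow> nat \<Rightarrow> ('a list \<Rightarrow>\<^sub>0 int) monoid" where
  "vr_chains X d k q = free_Abelian_group (vr_simplices X d k q)"

definition omit :: "nat \<Rightarrow> 'a list \<Rightarrow> 'a list" where
  "omit i xs = take i xs @ drop (Suc i) xs"

definition vr_boundary :: "('a list \<Rightarrow>\<^sub>0 int) \<Rightarrow> ('a list \<Rightarrow>\<^sub>0 int)" where
  "vr_boundary = frag_extend (\<lambda>xs. \<Sum>i<length xs. frag_cmul ((-1) ^ i) (frag_of (omit i xs)))"

definition augmentation :: "('a list \<Rightarrow>\<^sub>0 int) \<Rightarrow> int" where
  "augmentation c = (\<Sum>\<sigma>\<in>Poly_Mapping.keys c. Poly_Mapping.lookup c \<sigma>)"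


section \<open>Reduced homology and the type FP of a metric space\<close>

fun vr_cycles :: "'a set \<Rightarrow> ('a \<Rightarrow> 'a \<Rightarrow> real) \<Rightarrow> real \<Rightarrow> nat \<Rightarrow> ('a list \<Rightarrow>\<^sub>0 int) set" where
  "vr_cycles X d k 0 = kernel (vr_chains X d k 0) integer_group augmentation"
| "vr_cycles X d k (Suc q) = kernel (vr_chains X d k (Suc q)) (vr_chains X d k q) vr_boundary"

definition vr_boundaries :: "'a set \<Rightarrow> ('a \<Rightarrow> 'a \<Rightarrow> real) \<Rightarrow> real \<Rightarrow> nat \<Rightarrow> ('a list \<Rightarrow>\<^sub>0 int) set" where
  "vr_boundaries X d k q = vr_boundary ` carrier (vr_chains X d k (Suc q))"

definition vr_reduced_homology ::
    "'a set \<Rightarrow> ('a \<Rightarrow> 'a \<Rightarrow> real) \<Rightarrow> nat \<Rightarrow> real \<Rightarrow> ('a list \<Rightarrow>\<^sub>0 int) set monoid" where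
  "vr_reduced_homology X d q k =
     (vr_chains X d k q)\<lparr>carrier := vr_cycles X d k q\<rparr> Mod vr_boundaries X d k q"

text \<open>
  For \<open>i \<le> j\<close> the inclusion of the complex at scale \<open>i\<close> into the one at scale \<open>j\<close> sends the class
  \<open>z + B\<^sub>i\<close> to \<open>z + B\<^sub>j\<close>.  As \<open>B\<^sub>i \<subseteq> B\<^sub>j\<close>, this is the set sum \<open>(z + B\<^sub>i) + B\<^sub>j\<close>.
\<close>

definition vr_homology_map ::
    "'a set \<Rightarrow> ('a \<Rightarrow> 'a \<Rightarrow> real) \<Rightarrow> nat \<Rightarrow> real \<Rightarrow> real \<Rightarrow>
     ('a list \<Rightarrow>\<^sub>0 int) set \<Rightarrow> ('a list \<Rightarrow>\<^sub>0 int) set" where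
  "vr_homology_map X d q i j A = A <#>\<^bsub>vr_chains X d j q\<^esub> vr_boundaries X d j q"

definition essentially_trivial ::
    "'i::linorder set \<Rightarrow> ('i \<Rightarrow> 'a monoid) \<Rightarrow> ('i \<Rightarrow> 'i \<Rightarrow> 'a \<Rightarrow> 'a) \<Rightarrow> bool" where
  "essentially_trivial I A f \<longleftrightarrow>
     (\<forall>i\<in>I. \<exists>j\<in>I. i \<le> j \<and> (\<forall>x\<in>carrier (A i). f i j x = \<one>\<^bsub>A j\<^esub>))"

definition type_FP :: "'a set \<Rightarrow> ('a \<Rightarrow> 'a \<Rightarrow> real) \<Rightarrow> nat \<Rightarrow> bool" where
  "type_FP X d m \<longleftrightarrow>
     (\<forall>q<m. essentially_trivial {0..} (vr_reduced_homology X d q) (vr_homology_map X d q))"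

definition group_type_FP :: "('a, 'b) monoid_scheme \<Rightarrow> ('a \<Rightarrow> 'a \<Rightarrow> real) \<Rightarrow> nat \<Rightarrow> bool" where
  "group_type_FP G d m \<longleftrightarrow> type_FP (carrier G) d m"


section \<open>Characters, the Sigma-invariants and the valuation\<close>

definition character :: "('a, 'b) monoid_scheme \<Rightarrow> ('a \<Rightarrow> real) \<Rightarrow> bool" where
  "character G \<chi> \<longleftrightarrow> \<chi> \<in> hom G \<lparr>carrier = UNIV, monoid.mult = (+), one = 0\<rparr>"

definition halfspace :: "('a, 'b) monoid_scheme \<Rightarrow> ('a \<Rightarrow> real) \<Rightarrow> 'a set" where
  "halfspace G \<chi> = {g \<in> carrier G. \<chi> g \<ge> 0}"

definition Sigma_inv ::
    "('a, 'b) monoid_scheme \<Rightarrow> ('a \<Rightarrow> 'a \<Rightarrow> real) \<Rightarrow> nat \<Rightarrow> ('a \<Rightarrow> real) set" where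
  "Sigma_inv G d m = {\<chi>. character G \<chi> \<and> type_FP (halfspace G \<chi>) d m}"

text \<open>On the zero chain this is the infimum of the empty set, that is \<open>\<infinity>\<close>.\<close>

definition valuation :: "('a \<Rightarrow> real) \<Rightarrow> ('a list \<Rightarrow>\<^sub>0 int) \<Rightarrow> ereal" where
  "valuation \<chi> c = (INF \<sigma>\<in>Poly_Mapping.keys c. ereal (Min (\<chi> ` set \<sigma>)))"


section \<open>Chain endomorphisms of complexes of modules over the group ring\<close>

text \<open>
  Elements of the integral group ring are elements of \<open>free_Abelian_group (carrier G)\<close>, acting on
  chains by the linear extension of diagonal left multiplication.
\<close>

definition group_ring_act ::
    "('a, 'b) monoid_scheme \<Rightarrow> ('a \<Rightarrow>\<^sub>0 int) \<Rightarrow> ('a list \<Rightarrow>\<^sub>0 int) \<Rightarrow> ('a list \<Rightarrow>\<^sub>0 int)" where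
  "group_ring_act G a c = frag_extend (\<lambda>g. frag_extend (\<lambda>xs. frag_of (map (mult G g) xs)) c) a"

definition group_ring_chain_endo ::
    "('a, 'b) monoid_scheme \<Rightarrow> ('a \<Rightarrow> 'a \<Rightarrow> real) \<Rightarrow> real \<Rightarrow> nat \<Rightarrow>
     (nat \<Rightarrow> ('a list \<Rightarrow>\<^sub>0 int) \<Rightarrow> ('a list \<Rightarrow>\<^sub>0 int)) \<Rightarrow> bool" where
  "group_ring_chain_endo G d k m \<phi> \<longleftrightarrow>
     (\<forall>q\<le>m. \<phi> q \<in> hom (vr_chains (carrier G) d k q) (vr_chains (carrier G) d k q)) \<and>
     (\<forall>q\<le>m. \<forall>a\<in>carrier (free_Abelian_group (carrier G)). \<forall>c\<in>carrier (vr_chains (carrier G) d k q).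
        \<phi> q (group_ring_act G a c) = group_ring_act G a (\<phi> q c)) \<and>
     (\<forall>q<m. \<forall>c\<in>carrier (vr_chains (carrier G) d k (Suc q)).
        vr_boundary (\<phi> (Suc q) c) = \<phi> q (vr_boundary c))"

definition extends_identity ::
    "('a, 'b) monoid_scheme \<Rightarrow> ('a \<Rightarrow> 'a \<Rightarrow> real) \<Rightarrow> real \<Rightarrow>
     (nat \<Rightarrow> ('a list \<Rightarrow>\<^sub>0 int) \<Rightarrow> ('a list \<Rightarrow>\<^sub>0 int)) \<Rightarrow> bool" where
  "extends_identity G d k \<phi> \<longleftrightarrow>
     (\<forall>c\<in>carrier (vr_chains (carrier G) d k 0). augmentation (\<phi> 0 c) = augmentation c)"

end

(* Chain endomorphisms are built and compared simplex by simplex, at the price of enlarging the scale.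
   If the half space is of type FP_m, start with x |-> x t for some t of positive character and extend
   to higher simplices by filling, equivariantly, inside translated half spaces. The fillings use only
   finitely many scales, which do not depend on k, so the map lands in VR_k as soon as k is large.
   Conversely, let phi raise the valuation on VR_l. Coning off from the first vertex gives a homotopy
   from the identity to phi that never leaves a superlevel set and has bounded scale, because there
   are only finitely many orbits of simplices. A cycle z in the half space bounds some c in VR_l(G);
   then phi^s c lies in the half space for large s and bounds phi^s z, which is homologous to z by
   telescoping the homotopy. *)

theory Submission
  imports Defs
begin

section \<open>The augmented simplicial chain complex on lists\<close>

text \<open>The augmentation is absorbed into the boundary: a list with one vertex has the empty
  list as its boundary, so the empty list spans the augmentation module. Reduced cycles are then the
  chains with zero boundary in every degree, and extending the identity on the integers becomes one
  more compatibility with the boundary.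

  The obstacle to equivariance is that a chosen filling need not commute with translations. Each
  orbit of non-empty lists contains exactly one list with first vertex \<open>\<one>\<close>;
  choices are made there and transported. The same representatives turn finiteness of balls into
  bounds valid for all simplices.

  The scales of the constructed map do not see k because a single vertex has scale 0 wherever it
  lies: the two ends of an edge, however long, go to a cycle of scale 0, which is filled at a scale
  fixed in advance, and so on upwards.\<close>

lemma frag_extend_frag_extend:
  "frag_extend f (frag_extend g c) = frag_extend (\<lambda>x. frag_extend f (g x)) c"
  by (induction c rule: frag_induction[OF subset_UNIV]) (auto simp: frag_extend_diff)

lemma keys_frag_extendE:
  assumes "\<tau> \<in> Poly_Mapping.keys (frag_extend f c)"
  obtains \<sigma> where "\<sigma> \<in> Poly_Mapping.keys c" "\<tau> \<in> Poly_Mapping.keys (f \<sigma>)"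
  using assms keys_frag_extend by fastforce

lemma keys_frag_extend_subset:
  assumes "Poly_Mapping.keys c \<subseteq> A" "\<And>\<sigma>. \<sigma> \<in> A \<Longrightarrow> Poly_Mapping.keys (f \<sigma>) \<subseteq> B"
  shows "Poly_Mapping.keys (frag_extend f c) \<subseteq> B"
  using assms by (blast elim: keys_frag_extendE)

lemma keys_diff_subset:
  "Poly_Mapping.keys a \<subseteq> A \<Longrightarrow> Poly_Mapping.keys b \<subseteq> A \<Longrightarrow>
    Poly_Mapping.keys (a - b :: 'a \<Rightarrow>\<^sub>0 int) \<subseteq> A"
  using keys_diff[of a b] by blast

lemma keys_add_subset:
  "Poly_Mapping.keys a \<subseteq> A \<Longrightarrow> Poly_Mapping.keys b \<subseteq> A \<Longrightarrow>
    Poly_Mapping.keys (a + b :: 'a \<Rightarrow>\<^sub>0 int) \<subseteq> A"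
  using keys_add[of a b] by blast

section \<open>Cones, induced maps and the recursive boundary formula\<close>

definition cone :: "'a \<Rightarrow> ('a list \<Rightarrow>\<^sub>0 int) \<Rightarrow> ('a list \<Rightarrow>\<^sub>0 int)" where
  "cone x = frag_extend (\<lambda>xs. frag_of (x # xs))"

definition push :: "('a \<Rightarrow> 'b) \<Rightarrow> ('a list \<Rightarrow>\<^sub>0 int) \<Rightarrow> ('b list \<Rightarrow>\<^sub>0 int)" where
  "push f = frag_extend (\<lambda>xs. frag_of (map f xs))"

lemma cone_simps [simp]:
  "cone x 0 = 0" "cone x (frag_of xs) = frag_of (x # xs)"
  "cone x (a + b) = cone x a + cone x b" "cone x (a - b) = cone x a - cone x b"
  by (simp_all add: cone_def frag_extend_add frag_extend_diff)

lemma push_simps [simp]: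
  "push f 0 = 0" "push f (frag_of xs) = frag_of (map f xs)"
  "push f (a + b) = push f a + push f b" "push f (a - b) = push f a - push f b"
  by (simp_all add: push_def frag_extend_add frag_extend_diff)

lemma vr_boundary_simps [simp]:
  "vr_boundary 0 = 0" "vr_boundary (a + b) = vr_boundary a + vr_boundary b"
  "vr_boundary (a - b) = vr_boundary a - vr_boundary b"
  by (simp_all add: vr_boundary_def frag_extend_add frag_extend_diff)

lemma vr_boundary_extend:
  "vr_boundary (frag_extend f c) = frag_extend (\<lambda>x. vr_boundary (f x)) c"
  by (simp add: vr_boundary_def frag_extend_frag_extend)

lemma frag_extend_vr_boundary:
  "frag_extend f (vr_boundary c) = frag_extend (\<lambda>x. frag_extend f (vr_boundary (frag_of x))) c"
  by (simp add: vr_boundary_def frag_extend_frag_extend)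

lemma push_extend: "push f (frag_extend g c) = frag_extend (\<lambda>x. push f (g x)) c"
  by (simp add: push_def frag_extend_frag_extend)

lemma extend_push: "frag_extend g (push f c) = frag_extend (\<lambda>x. g (map f x)) c"
  by (simp add: push_def frag_extend_frag_extend)

lemma push_cone: "push f (cone x c) = cone (f x) (push f c)"
  by (simp add: push_def cone_def frag_extend_frag_extend)

lemma push_push: "push f (push g c) = push (f \<circ> g) c"
  by (simp add: push_def frag_extend_frag_extend)

lemma push_cong:
  "(\<And>xs x. xs \<in> Poly_Mapping.keys c \<Longrightarrow> x \<in> set xs \<Longrightarrow> f x = g x) \<Longrightarrow> push f c = push g c"
  unfolding push_def by (intro frag_extend_eq arg_cong[where f = frag_of] map_cong) auto

lemma push_id: "(\<And>xs x. xs \<in> Poly_Mapping.keys c \<Longrightarrow> x \<in> set xs \<Longrightarrow> f x = x) \<Longrightarrow> push f c = c"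
  using push_cong[of c f "\<lambda>x. x"] frag_expansion[of c] by (simp add: push_def)

lemma keys_push_subset: "Poly_Mapping.keys (push f c) \<subseteq> map f ` Poly_Mapping.keys c"
  unfolding push_def by (rule keys_frag_extend_subset[OF subset_refl]) auto

lemma keys_cone_subset: "Poly_Mapping.keys (cone x c) \<subseteq> (#) x ` Poly_Mapping.keys c"
  unfolding cone_def by (rule keys_frag_extend_subset[OF subset_refl]) auto

lemma vr_boundary_Nil [simp]: "vr_boundary (frag_of []) = 0"
  by (simp add: vr_boundary_def)

text \<open>Omitting entry i + 1 of \<open>x # xs\<close> means omitting entry i of
  \<open>xs\<close> and putting \<open>x\<close> back, with the opposite sign. This recursion
  replaces the alternating sum, so that later identities follow by induction on the list.\<close>

lemma vr_boundary_Cons [simp]: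
  "vr_boundary (frag_of (x # xs)) = frag_of xs - cone x (vr_boundary (frag_of xs))"
proof -
  have "frag_cmul ((-1) ^ Suc i) (frag_of (omit (Suc i) (x # xs)))
      = - cone x (frag_cmul ((-1) ^ i) (frag_of (omit i xs)))" for i
    unfolding cone_def by (simp add: frag_extend_cmul omit_def)
  then have "vr_boundary (frag_of (x # xs)) = frag_of xs
      - (\<Sum>i<length xs. cone x (frag_cmul ((-1) ^ i) (frag_of (omit i xs))))"
    unfolding vr_boundary_def
    by (simp add: sum.lessThan_Suc_shift sum_negf omit_def del: power_Suc sum.lessThan_Suc)
  also have "(\<Sum>i<length xs. cone x (frag_cmul ((-1) ^ i) (frag_of (omit i xs))))
      = cone x (vr_boundary (frag_of xs))"
    by (simp add: cone_def vr_boundary_def frag_extend_sum o_def)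
  finally show ?thesis .
qed

text \<open>Coning contracts the augmented complex, the empty list included, whose cone is a single
  vertex. Every cycle is thus the boundary of its cone with any apex; only the location and the
  scale of the cone remain to be controlled.\<close>

lemma vr_boundary_cone: "vr_boundary (cone x c) = c - cone x (vr_boundary c)"
  by (induction c rule: frag_induction[OF subset_UNIV]) auto

lemma vr_boundary_boundary [simp]: "vr_boundary (vr_boundary c) = 0"
proof (induction c rule: frag_induction[OF subset_UNIV])
  case (2 xs)
  show ?case
    by (induction xs) (auto simp: vr_boundary_cone)
qed auto

lemma vr_boundary_push: "vr_boundary (push f c) = push f (vr_boundary c)"
proof (induction c rule: frag_induction[OF subset_UNIV])
  case (2 xs)
  show ?case
    by (induction xs) (auto simp: push_cone)
qed auto

text \<open>Only an inclusion, since faces of a list with repeated entries may cancel.\<close>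

lemma keys_vr_boundary:
  "Poly_Mapping.keys (vr_boundary (frag_of xs)) \<subseteq> {ys. Suc (length ys) = length xs \<and> set ys \<subseteq> set xs}"
proof (induction xs)
  case (Cons x xs)
  have "Poly_Mapping.keys (cone x (vr_boundary (frag_of xs)))
      \<subseteq> {ys. Suc (length ys) = length (x # xs) \<and> set ys \<subseteq> set (x # xs)}"
    using Cons keys_cone_subset by fastforce
  then show ?case
    by (auto dest!: subsetD[OF keys_diff])
qed simp

lemma augmentation_diff: "augmentation (a - b) = augmentation a - augmentation b"
proof -
  \<comment> \<open>Cancellation can shrink the support of a difference, so all three sums are first
    taken over one common finite set.\<close>
  have *: "augmentation c = (\<Sum>\<sigma>\<in>A. Poly_Mapping.lookup c \<sigma>)"
    if "finite A" "Poly_Mapping.keys c \<subseteq> A" for A and c :: "'a list \<Rightarrow>\<^sub>0 int"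
    unfolding augmentation_def using that by (intro sum.mono_neutral_left) (auto simp: in_keys_iff)
  let ?A = "Poly_Mapping.keys a \<union> Poly_Mapping.keys b"
  have "Poly_Mapping.keys (a - b) \<subseteq> ?A"
    by (rule keys_diff)
  then show ?thesis
    by (simp add: *[of ?A] sum_subtractf lookup_minus)
qed

text \<open>Identifies the augmentation with the boundary from single vertices to multiples of the
  empty list.\<close>

lemma vr_boundary_augmentation:
  assumes "\<And>xs. xs \<in> Poly_Mapping.keys c \<Longrightarrow> length xs = 1"
  shows "vr_boundary c = frag_cmul (augmentation c) (frag_of [])"
proof -
  have "Poly_Mapping.keys c \<subseteq> {xs. length xs = 1}"
    using assms by auto
  then show ?thesis
  proof (induction c rule: frag_induction)
    case (one xs)
    then show ?case
      by (auto simp: augmentation_def length_Suc_conv)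
  qed (auto simp: augmentation_def[of 0] augmentation_diff frag_cmul_diff_distrib)
qed

section \<open>Vietoris--Rips chains and essential triviality\<close>

text \<open>Indexed by the number of vertices rather than by the dimension, so that n = 0 gives the
  simplex of degree -1, the empty list.\<close>

definition vr_lists :: "'a set \<Rightarrow> ('a \<Rightarrow> 'a \<Rightarrow> real) \<Rightarrow> real \<Rightarrow> nat \<Rightarrow> 'a list set" where
  "vr_lists X d k n = {xs. length xs = n \<and> set xs \<subseteq> X \<and> (\<forall>x\<in>set xs. \<forall>y\<in>set xs. d x y \<le> k)}"

lemma vr_simplices_eq: "vr_simplices X d k q = vr_lists X d k (Suc q)"
  by (simp add: vr_simplices_def vr_lists_def)

lemma vr_lists_mono: "X \<subseteq> Y \<Longrightarrow> k \<le> l \<Longrightarrow> vr_lists X d k n \<subseteq> vr_lists Y d l n"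
  unfolding vr_lists_def by (force intro: order_trans)

lemma carrier_vr_chains:
  "c \<in> carrier (vr_chains X d k q) \<longleftrightarrow> Poly_Mapping.keys c \<subseteq> vr_lists X d k (Suc q)"
  by (simp add: vr_chains_def vr_simplices_eq)

lemma keys_vr_boundary_vr_lists:
  assumes "Poly_Mapping.keys c \<subseteq> vr_lists X d k (Suc n)"
  shows "Poly_Mapping.keys (vr_boundary c) \<subseteq> vr_lists X d k n"
proof -
  have "vr_boundary c = frag_extend (\<lambda>x. vr_boundary (frag_of x)) c"
    using vr_boundary_extend[of frag_of c] frag_expansion[of c] by simp
  also have "Poly_Mapping.keys \<dots> \<subseteq> vr_lists X d k n"
  proof (rule keys_frag_extend_subset[OF assms])
    fix \<sigma> assume "\<sigma> \<in> vr_lists X d k (Suc n)"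
    then show "Poly_Mapping.keys (vr_boundary (frag_of \<sigma>)) \<subseteq> vr_lists X d k n"
      unfolding vr_lists_def by (intro order_trans[OF keys_vr_boundary]) auto
  qed
  finally show ?thesis .
qed

lemma vr_cycles_eq:
  "vr_cycles X d k q = {z. Poly_Mapping.keys z \<subseteq> vr_lists X d k (Suc q) \<and> vr_boundary z = 0}"
proof (cases q)
  case 0
  have "vr_boundary z = 0 \<longleftrightarrow> augmentation z = 0"
    if "Poly_Mapping.keys z \<subseteq> vr_lists X d k (Suc 0)" for z
    using that by (subst vr_boundary_augmentation) (auto simp: vr_lists_def)
  then show ?thesis
    using 0 by (auto simp: kernel_def carrier_vr_chains integer_group_def)
next
  case (Suc n)
  then show ?thesis
    by (auto simp: kernel_def carrier_vr_chains) (auto simp: vr_chains_def)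
qed

text \<open>The class of \<open>z\<close> maps to \<open>(z + B\<^sub>i) + B\<^sub>j\<close>, which is \<open>B\<^sub>j\<close> exactly when \<open>z \<in> B\<^sub>j\<close>.\<close>

lemma essentially_trivial_iff:
  "essentially_trivial {0..} (vr_reduced_homology X d q) (vr_homology_map X d q) \<longleftrightarrow>
    (\<forall>i\<ge>0. \<exists>j\<ge>i. \<forall>z. Poly_Mapping.keys z \<subseteq> vr_lists X d i (Suc q) \<longrightarrow> vr_boundary z = 0 \<longrightarrow>
      (\<exists>c. Poly_Mapping.keys c \<subseteq> vr_lists X d j (Suc (Suc q)) \<and> vr_boundary c = z))"
proof -
  let ?B = "\<lambda>k. vr_boundaries X d k q"
  have B: "?B k = vr_boundary ` {c. Poly_Mapping.keys c \<subseteq> vr_lists X d k (Suc (Suc q))}" for k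
    by (auto simp: vr_boundaries_def carrier_vr_chains)
  have zero: "0 \<in> ?B k" for k
    by (auto simp: B image_iff intro!: exI[of _ 0])
  have add: "a + b \<in> ?B k" if "a \<in> ?B k" "b \<in> ?B k" for a b k
  proof -
    from that obtain a' b' where "Poly_Mapping.keys a' \<subseteq> vr_lists X d k (Suc (Suc q))"
      "Poly_Mapping.keys b' \<subseteq> vr_lists X d k (Suc (Suc q))" "a = vr_boundary a'" "b = vr_boundary b'"
      unfolding B by blast
    then show ?thesis
      unfolding B by (intro image_eqI[of _ _ "a' + b'"]) (auto dest: subsetD[OF keys_add_subset])
  qed
  have diff: "a - b \<in> ?B k" if "a \<in> ?B k" "b \<in> ?B k" for a b k
  proof -
    from that obtain a' b' where "Poly_Mapping.keys a' \<subseteq> vr_lists X d k (Suc (Suc q))"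
      "Poly_Mapping.keys b' \<subseteq> vr_lists X d k (Suc (Suc q))" "a = vr_boundary a'" "b = vr_boundary b'"
      unfolding B by blast
    then show ?thesis
      unfolding B by (intro image_eqI[of _ _ "a' - b'"]) (auto dest: subsetD[OF keys_diff_subset])
  qed
  have mono: "?B i \<subseteq> ?B j" if "i \<le> j" for i j
    unfolding B using vr_lists_mono[OF subset_refl that] by fast
  have map: "vr_homology_map X d q i j (\<Union>h\<in>?B i. {h + z}) = ?B j \<longleftrightarrow> z \<in> ?B j"
    if ij: "i \<le> j" for i j z
  proof -
    have eq: "vr_homology_map X d q i j (\<Union>h\<in>?B i. {h + z}) = (\<Union>h\<in>?B i. \<Union>k\<in>?B j. {h + z + k})"
      by (auto simp: vr_homology_map_def set_mult_def vr_chains_def)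
    show ?thesis
    proof
      assume "vr_homology_map X d q i j (\<Union>h\<in>?B i. {h + z}) = ?B j"
      moreover have "0 + z + 0 \<in> (\<Union>h\<in>?B i. \<Union>k\<in>?B j. {h + z + k})"
        using zero by blast
      ultimately show "z \<in> ?B j"
        using eq by simp
    next
      assume z: "z \<in> ?B j"
      have "b \<in> (\<Union>h\<in>?B i. \<Union>k\<in>?B j. {h + z + k})" if "b \<in> ?B j" for b
      proof -
        have "b = 0 + z + (b - z)"
          by simp
        then show ?thesis
          using zero[of i] diff[OF that z] by blast
      qed
      then show "vr_homology_map X d q i j (\<Union>h\<in>?B i. {h + z}) = ?B j"
        using eq add mono[OF ij] z by auto
    qed
  qed
  have carrier: "carrier (vr_reduced_homology X d q i) =
      (\<lambda>z. \<Union>h\<in>?B i. {h + z}) ` vr_cycles X d i q" for i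
    by (auto simp: vr_reduced_homology_def FactGroup_def RCOSETS_def r_coset_def vr_chains_def)
  have one: "\<one>\<^bsub>vr_reduced_homology X d q j\<^esub> = ?B j" for j
    by (simp add: vr_reduced_homology_def FactGroup_def)
  have iff: "(\<forall>x\<in>carrier (vr_reduced_homology X d q i). vr_homology_map X d q i j x
        = \<one>\<^bsub>vr_reduced_homology X d q j\<^esub>) \<longleftrightarrow>
      (\<forall>z. Poly_Mapping.keys z \<subseteq> vr_lists X d i (Suc q) \<longrightarrow> vr_boundary z = 0 \<longrightarrow>
      (\<exists>c. Poly_Mapping.keys c \<subseteq> vr_lists X d j (Suc (Suc q)) \<and> vr_boundary c = z))" if "i \<le> j" for i j
  proof -
    have "(\<forall>x\<in>carrier (vr_reduced_homology X d q i). vr_homology_map X d q i j x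
        = \<one>\<^bsub>vr_reduced_homology X d q j\<^esub>) \<longleftrightarrow> (\<forall>z\<in>vr_cycles X d i q. z \<in> ?B j)"
      unfolding carrier one by (simp only: ball_simps map[OF that])
    moreover have "z \<in> ?B j \<longleftrightarrow>
        (\<exists>c. Poly_Mapping.keys c \<subseteq> vr_lists X d j (Suc (Suc q)) \<and> vr_boundary c = z)" for z
      unfolding B by blast
    ultimately show ?thesis
      by (simp add: vr_cycles_eq Ball_def imp_conjL)
  qed
  have index: "(\<forall>i\<in>{0::real..}. \<exists>j\<in>{0..}. i \<le> j \<and> P i j) \<longleftrightarrow> (\<forall>i\<ge>0. \<exists>j\<ge>i. Q i j)"
    if "\<And>i j. i \<le> j \<Longrightarrow> P i j \<longleftrightarrow> Q i j" for P Q
    using that by (meson atLeast_iff order_trans)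
  show ?thesis
    unfolding essentially_trivial_def by (rule index) (rule iff)
qed

section \<open>Left-invariant proper metrics\<close>

text \<open>What the argument draws from a word metric: zero self-distance puts single vertices at
  scale 0, left invariance lets translations preserve scales, and finite balls leave finitely many
  orbits of simplices.\<close>

locale proper_metric_group = group G for G :: "('a, 'b) monoid_scheme" (structure) +
  fixes d :: "'a \<Rightarrow> 'a \<Rightarrow> real"
  assumes dist_self: "x \<in> carrier G \<Longrightarrow> d x x = 0"
    and dist_mult_left: "g \<in> carrier G \<Longrightarrow> x \<in> carrier G \<Longrightarrow> y \<in> carrier G \<Longrightarrow>
      d (g \<otimes> x) (g \<otimes> y) = d x y"
    and finite_ball: "finite {x \<in> carrier G. d \<one> x \<le> k}"

section \<open>Word lengths and the properness of word metrics\<close>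

lemma (in group) foldr_mult_append:
  "set xs \<subseteq> carrier G \<Longrightarrow> set ys \<subseteq> carrier G \<Longrightarrow>
    foldr (\<otimes>) (xs @ ys) \<one> = foldr (\<otimes>) xs \<one> \<otimes> foldr (\<otimes>) ys \<one>"
proof (induction xs)
  have "foldr (\<otimes>) zs \<one> \<in> carrier G" if "set zs \<subseteq> carrier G" for zs
    using that by (induction zs) auto
  note closed = this
  { case Nil then show ?case using closed by simp }
  { case (Cons x xs) then show ?case using closed by (simp add: m_assoc) }
qed

text \<open>Every element is a word in the generators and their inverses, by induction on
  \<open>generate\<close>, so the \<open>LEAST\<close> in the word length ranges over a non-empty
  set and is attained.\<close>

lemma (in group) word_length_attained:
  assumes "finite_generating_set G S" "g \<in> carrier G"
  obtains ws where "length ws = word_length G S g" "set ws \<subseteq> S \<union> m_inv G ` S" "foldr (\<otimes>) ws \<one> = g"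
proof -
  have S: "S \<subseteq> carrier G" "generate G S = carrier G"
    using assms(1) by (auto simp: finite_generating_set_def)
  have "g \<in> generate G S"
    using assms S by simp
  then have "\<exists>ws. set ws \<subseteq> S \<union> m_inv G ` S \<and> foldr (\<otimes>) ws \<one> = g"
  proof induction
    case one
    show ?case by (intro exI[of _ "[]"]) simp
  next
    case (incl h)
    then show ?case using S by (intro exI[of _ "[h]"]) auto
  next
    case (inv h)
    then show ?case using S by (intro exI[of _ "[inv h]"]) auto
  next
    case (eng h1 h2)
    then obtain ws1 ws2 where ws: "set ws1 \<subseteq> S \<union> m_inv G ` S" "foldr (\<otimes>) ws1 \<one> = h1"
      "set ws2 \<subseteq> S \<union> m_inv G ` S" "foldr (\<otimes>) ws2 \<one> = h2"
      by blast
    moreover have "S \<union> m_inv G ` S \<subseteq> carrier G"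
      using S by auto
    ultimately show ?case
      by (intro exI[of _ "ws1 @ ws2"]) (subst foldr_mult_append, auto)
  qed
  then have "\<exists>n ws. length ws = n \<and> set ws \<subseteq> S \<union> m_inv G ` S \<and> foldr (\<otimes>) ws \<one> = g"
    by blast
  from LeastI_ex[OF this] show ?thesis
    using that unfolding word_length_def by blast
qed

text \<open>Serves both cases of \<open>group_metric\<close>; a finitely generated group is embedded
  in itself by the identity. Invariance and zero self-distance pull back along a homomorphism,
  finiteness of balls along an injection.\<close>

lemma proper_metric_group_embedding:
  assumes G: "group G" and H: "group H" and S: "finite_generating_set H S" and i: "i \<in> mon G H"
    and d: "\<And>g h. g \<in> carrier G \<Longrightarrow> h \<in> carrier G \<Longrightarrow> d g h = word_metric H S (i g) (i h)"
  shows "proper_metric_group G d"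
proof -
  interpret G: group G by fact
  interpret H: group H by fact
  have hom: "i \<in> hom G H" and inj: "inj_on i (carrier G)"
    using i by (auto simp: mon_def)
  interpret i: group_hom G H i
    using hom by unfold_locales
  note G.group_axioms
  moreover have "d x x = 0" if "x \<in> carrier G" for x
  proof -
    have "word_length H S \<one>\<^bsub>H\<^esub> = 0"
      unfolding word_length_def by (intro Least_eq_0) auto
    then show ?thesis
      using that by (simp add: d word_metric_def)
  qed
  moreover have "d (g \<otimes>\<^bsub>G\<^esub> x) (g \<otimes>\<^bsub>G\<^esub> y) = d x y"
    if "g \<in> carrier G" "x \<in> carrier G" "y \<in> carrier G" for g x y
  proof -
    have "inv\<^bsub>H\<^esub> (i (g \<otimes>\<^bsub>G\<^esub> x)) \<otimes>\<^bsub>H\<^esub> i (g \<otimes>\<^bsub>G\<^esub> y) = inv\<^bsub>H\<^esub> (i x) \<otimes>\<^bsub>H\<^esub> i y"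
      using that by (simp add: H.inv_mult_group H.m_assoc) (simp add: H.m_assoc[symmetric])
    then show ?thesis
      using that by (simp add: d word_metric_def)
  qed
  moreover have "finite {x \<in> carrier G. d \<one>\<^bsub>G\<^esub> x \<le> k}" for k
  proof -
    \<comment> \<open>A ball in the overgroup is covered by the words of bounded length over a
      finite alphabet.\<close>
    let ?L = "{ws. set ws \<subseteq> S \<union> m_inv H ` S \<and> length ws \<le> nat \<lfloor>k\<rfloor>}"
    have "finite ?L"
      using S by (intro finite_lists_length_le) (auto simp: finite_generating_set_def)
    moreover have "i ` {x \<in> carrier G. d \<one>\<^bsub>G\<^esub> x \<le> k} \<subseteq> (\<lambda>ws. foldr (mult H) ws \<one>\<^bsub>H\<^esub>) ` ?L"
    proof safe
      fix x assume x: "x \<in> carrier G" "d \<one>\<^bsub>G\<^esub> x \<le> k"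
      then have "real (word_length H S (i x)) \<le> k"
        by (simp add: d word_metric_def)
      moreover obtain ws where "length ws = word_length H S (i x)"
        "set ws \<subseteq> S \<union> m_inv H ` S" "foldr (mult H) ws \<one>\<^bsub>H\<^esub> = i x"
        using H.word_length_attained[OF S, of "i x"] x by auto
      ultimately show "i x \<in> (\<lambda>ws. foldr (mult H) ws \<one>\<^bsub>H\<^esub>) ` ?L"
        by (intro image_eqI[of _ _ ws]) (auto simp: le_nat_floor)
    qed
    ultimately have "finite (i ` {x \<in> carrier G. d \<one>\<^bsub>G\<^esub> x \<le> k})"
      by (rule finite_surj)
    then show ?thesis
      by (rule finite_imageD) (use inj in \<open>auto intro: inj_on_subset\<close>)
  qed
  ultimately show ?thesis
    by (simp add: proper_metric_group_def proper_metric_group_axioms_def)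
qed

lemma group_metric_imp_proper:
  assumes "group G" "group_metric G d"
  shows "proper_metric_group G d"
proof (cases "finitely_generated_group G")
  case True
  with assms(2) obtain S where S: "finite_generating_set G S"
    "\<And>g h. g \<in> carrier G \<Longrightarrow> h \<in> carrier G \<Longrightarrow> d g h = word_metric G S g h"
    by (auto simp: group_metric_def)
  have "(\<lambda>x. x) \<in> mon G G"
    by (auto simp: mon_def hom_def)
  from proper_metric_group_embedding[OF assms(1,1) S(1) this] S(2) show ?thesis
    by blast
next
  case False
  with assms(2) obtain H :: "nat monoid" and S i where "group H" "finite_generating_set H S" "i \<in> mon G H"
    "\<And>g h. g \<in> carrier G \<Longrightarrow> h \<in> carrier G \<Longrightarrow> d g h = word_metric H S (i g) (i h)"
    by (auto simp: group_metric_def)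
  from proper_metric_group_embedding[OF assms(1) this] show ?thesis .
qed


section \<open>Characters and superlevel sets\<close>

locale metric_group_character = proper_metric_group G d
  for G :: "('a, 'b) monoid_scheme" (structure) and d +
  fixes \<chi> :: "'a \<Rightarrow> real"
  assumes character_mult: "x \<in> carrier G \<Longrightarrow> y \<in> carrier G \<Longrightarrow> \<chi> (x \<otimes> y) = \<chi> x + \<chi> y"
begin

text \<open>For \<open>r = \<chi> g\<close> this is the translate of the half space by g; for a real
  number that is not a value of \<open>\<chi>\<close> it need not be a translate.\<close>

definition superlevel :: "real \<Rightarrow> 'a set" where
  "superlevel r = {x \<in> carrier G. r \<le> \<chi> x}"

abbreviation act :: "'a \<Rightarrow> ('a list \<Rightarrow>\<^sub>0 int) \<Rightarrow> ('a list \<Rightarrow>\<^sub>0 int)" where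
  "act g \<equiv> push (\<lambda>x. g \<otimes> x)"

lemma superlevel_subset: "superlevel r \<subseteq> carrier G"
  by (auto simp: superlevel_def)

lemma superlevel_antimono: "s \<le> r \<Longrightarrow> superlevel r \<subseteq> superlevel s"
  by (auto simp: superlevel_def)

lemma halfspace_eq: "halfspace G \<chi> = superlevel 0"
  by (simp add: halfspace_def superlevel_def)

lemma character_one [simp]: "\<chi> \<one> = 0"
  using character_mult[of \<one> \<one>] by simp

lemma character_inv [simp]: "g \<in> carrier G \<Longrightarrow> \<chi> (inv g) = - \<chi> g"
  using character_mult[of "inv g" g] by simp

lemma vr_lists_superlevel_subset: "vr_lists (superlevel r) d k n \<subseteq> vr_lists (carrier G) d k n"
  by (rule vr_lists_mono[OF superlevel_subset order_refl])

lemma map_mult_vr_lists: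
  assumes "g \<in> carrier G" "\<sigma> \<in> vr_lists (carrier G) d k n"
  shows "map (\<lambda>x. g \<otimes> x) \<sigma> \<in> vr_lists (carrier G) d k n"
  using assms by (auto simp: vr_lists_def dist_mult_left subset_iff)

lemma map_mult_superlevel:
  assumes "g \<in> carrier G" "set \<sigma> \<subseteq> superlevel r"
  shows "set (map (\<lambda>x. g \<otimes> x) \<sigma>) \<subseteq> superlevel (\<chi> g + r)"
  using assms by (auto simp: superlevel_def character_mult subset_iff)

lemma map_mult_vr_lists_superlevel:
  assumes "g \<in> carrier G" "\<sigma> \<in> vr_lists (superlevel r) d k n"
  shows "map (\<lambda>x. g \<otimes> x) \<sigma> \<in> vr_lists (superlevel (\<chi> g + r)) d k n"
proof -
  have "\<sigma> \<in> vr_lists (carrier G) d k n" "set \<sigma> \<subseteq> superlevel r"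
    using assms vr_lists_superlevel_subset by (blast, simp add: vr_lists_def)
  from map_mult_vr_lists[OF assms(1) this(1)] map_mult_superlevel[OF assms(1) this(2)] show ?thesis
    by (simp add: vr_lists_def)
qed

lemma keys_act_vr_lists:
  assumes "g \<in> carrier G" "Poly_Mapping.keys c \<subseteq> vr_lists (carrier G) d k n"
  shows "Poly_Mapping.keys (act g c) \<subseteq> vr_lists (carrier G) d k n"
  using keys_push_subset map_mult_vr_lists[OF assms(1)] assms(2) by fast

lemma keys_act_superlevel:
  assumes "g \<in> carrier G" "Poly_Mapping.keys c \<subseteq> vr_lists (superlevel r) d k n"
  shows "Poly_Mapping.keys (act g c) \<subseteq> vr_lists (superlevel (\<chi> g + r)) d k n"
  using keys_push_subset map_mult_vr_lists_superlevel[OF assms(1)] assms(2) by fast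

lemma act_act:
  assumes "g \<in> carrier G" "h \<in> carrier G" "\<And>\<sigma>. \<sigma> \<in> Poly_Mapping.keys c \<Longrightarrow> set \<sigma> \<subseteq> carrier G"
  shows "act g (act h c) = act (g \<otimes> h) c"
  unfolding push_push by (rule push_cong) (use assms in \<open>auto simp: m_assoc subset_iff\<close>)

lemma act_one:
  assumes "\<And>\<sigma>. \<sigma> \<in> Poly_Mapping.keys c \<Longrightarrow> set \<sigma> \<subseteq> carrier G"
  shows "act \<one> c = c"
  by (rule push_id) (use assms in \<open>auto simp: subset_iff\<close>)

lemma map_mult_inv:
  assumes "g \<in> carrier G" "set \<sigma> \<subseteq> carrier G"
  shows "map (\<lambda>x. g \<otimes> x) (map (\<lambda>x. inv g \<otimes> x) \<sigma>) = \<sigma>"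
  using assms by (auto simp: m_assoc[symmetric] subset_iff intro!: map_idI)

text \<open>The representative of the orbit of a simplex whose first vertex is
  \<open>\<one>\<close>.\<close>

definition normalize :: "'a list \<Rightarrow> 'a list" where
  "normalize \<sigma> = map (\<lambda>x. inv (hd \<sigma>) \<otimes> x) \<sigma>"

lemma length_normalize [simp]: "length (normalize \<sigma>) = length \<sigma>"
  by (simp add: normalize_def)

lemma hd_in_carrier: "set \<sigma> \<subseteq> carrier G \<Longrightarrow> \<sigma> \<noteq> [] \<Longrightarrow> hd \<sigma> \<in> carrier G"
  by (cases \<sigma>) auto

lemma normalize_carrier: "set \<sigma> \<subseteq> carrier G \<Longrightarrow> set (normalize \<sigma>) \<subseteq> carrier G"
  by (cases \<sigma>) (auto simp: normalize_def subset_iff)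

lemma map_hd_normalize:
  "set \<sigma> \<subseteq> carrier G \<Longrightarrow> map (\<lambda>x. hd \<sigma> \<otimes> x) (normalize \<sigma>) = \<sigma>"
  using map_mult_inv[of "hd \<sigma>" \<sigma>] hd_in_carrier[of \<sigma>] by (cases "\<sigma> = []") (auto simp: normalize_def)

lemma normalize_map_mult:
  assumes "g \<in> carrier G" "set \<sigma> \<subseteq> carrier G"
  shows "normalize (map (\<lambda>x. g \<otimes> x) \<sigma>) = normalize \<sigma>"
proof (cases \<sigma>)
  case (Cons x xs)
  then have x: "x \<in> carrier G"
    using assms by auto
  have "inv (g \<otimes> x) \<otimes> (g \<otimes> y) = inv x \<otimes> y" if "y \<in> carrier G" for y
  proof -
    have "inv (g \<otimes> x) \<otimes> (g \<otimes> y) = inv x \<otimes> (inv g \<otimes> (g \<otimes> y))"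
      using assms x that by (simp add: inv_mult_group m_assoc)
    also have "inv g \<otimes> (g \<otimes> y) = y"
      using assms that by (simp add: m_assoc[symmetric])
    finally show ?thesis .
  qed
  then show ?thesis
    using Cons assms by (auto simp: normalize_def subset_iff)
qed (simp add: normalize_def)

lemma normalize_vr_lists:
  assumes "\<sigma> \<in> vr_lists (carrier G) d k (Suc n)"
  shows "normalize \<sigma> \<in> {\<rho> \<in> vr_lists (carrier G) d k (Suc n). hd \<rho> = \<one>}"
proof -
  from assms have \<sigma>: "set \<sigma> \<subseteq> carrier G" "\<sigma> \<noteq> []"
    by (auto simp: vr_lists_def)
  then have "hd \<sigma> \<in> carrier G"
    using hd_in_carrier by blast
  then show ?thesis
    using map_mult_vr_lists[of "inv (hd \<sigma>)", OF _ assms] \<sigma>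
    by (simp add: normalize_def hd_map)
qed

text \<open>All vertices lie within distance k of the first vertex \<open>\<one>\<close>, hence in a
  finite ball.\<close>

lemma finite_orbit_representatives: "finite {\<rho> \<in> vr_lists (carrier G) d k (Suc n). hd \<rho> = \<one>}"
proof (rule finite_subset)
  let ?B = "{x \<in> carrier G. d \<one> x \<le> k}"
  show "{\<rho> \<in> vr_lists (carrier G) d k (Suc n). hd \<rho> = \<one>} \<subseteq> {xs. set xs \<subseteq> ?B \<and> length xs = Suc n}"
  proof
    fix \<rho> assume \<rho>: "\<rho> \<in> {\<rho> \<in> vr_lists (carrier G) d k (Suc n). hd \<rho> = \<one>}"
    then have "\<one> \<in> set \<rho>"
      using hd_in_set[of \<rho>] by (cases "\<rho> = []") (auto simp: vr_lists_def)
    with \<rho> show "\<rho> \<in> {xs. set xs \<subseteq> ?B \<and> length xs = Suc n}"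
      by (auto simp: vr_lists_def)
  qed
  show "finite {xs. set xs \<subseteq> ?B \<and> length xs = Suc n}"
    by (rule finite_lists_length_eq) (rule finite_ball)
qed

end

section \<open>From fillings in the half space to a valuation-increasing chain map\<close>

text \<open>\<open>K q\<close> is the scale at which images of q-simplices will live; each degree
  consumes one application of the filling property.\<close>

locale filled_halfspace = metric_group_character G d \<chi>
  for G :: "('a, 'b) monoid_scheme" (structure) and d \<chi> +
  fixes t :: 'a and K :: "nat \<Rightarrow> real" and m :: nat
  assumes t: "t \<in> carrier G"
    and K_nonneg: "0 \<le> K q" and K_step: "K q \<le> K (Suc q)"
    and filling: "q < m \<Longrightarrow> Poly_Mapping.keys z \<subseteq> vr_lists (superlevel 0) d (K q) (Suc q) \<Longrightarrow>
      vr_boundary z = 0 \<Longrightarrow>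
      \<exists>c. Poly_Mapping.keys c \<subseteq> vr_lists (superlevel 0) d (K (Suc q)) (Suc (Suc q)) \<and> vr_boundary c = z"
begin

text \<open>The choice depends only on the degree, the level and the cycle, so evaluating it on
  orbit representatives gives one choice per orbit.\<close>

definition fill :: "nat \<Rightarrow> real \<Rightarrow> ('a list \<Rightarrow>\<^sub>0 int) \<Rightarrow> ('a list \<Rightarrow>\<^sub>0 int)" where
  "fill q r z = (SOME c. Poly_Mapping.keys c \<subseteq> vr_lists (superlevel r) d (K (Suc q)) (Suc (Suc q)) \<and>
     vr_boundary c = z)"

text \<open>Translating by \<open>inv g\<close> moves the cycle into the half space, where it can be
  filled; translating back gives the filling. This is why the level has to be a value of
  \<open>\<chi>\<close>.\<close>

lemma fill:
  assumes "q < m" "g \<in> carrier G"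
    and z: "Poly_Mapping.keys z \<subseteq> vr_lists (superlevel (\<chi> g)) d (K q) (Suc q)" "vr_boundary z = 0"
  shows "Poly_Mapping.keys (fill q (\<chi> g) z) \<subseteq> vr_lists (superlevel (\<chi> g)) d (K (Suc q)) (Suc (Suc q))"
    and "vr_boundary (fill q (\<chi> g) z) = z"
proof -
  have "Poly_Mapping.keys (act (inv g) z) \<subseteq> vr_lists (superlevel 0) d (K q) (Suc q)"
    using keys_act_superlevel[OF _ z(1), of "inv g"] \<open>g \<in> carrier G\<close> by simp
  moreover have "vr_boundary (act (inv g) z) = 0"
    by (simp add: vr_boundary_push z)
  ultimately obtain c where c: "Poly_Mapping.keys c \<subseteq> vr_lists (superlevel 0) d (K (Suc q)) (Suc (Suc q))"
    "vr_boundary c = act (inv g) z"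
    using filling[OF \<open>q < m\<close>] by blast
  have "act g (act (inv g) z) = act (g \<otimes> inv g) z"
    by (rule act_act) (use assms vr_lists_superlevel_subset in \<open>auto simp: vr_lists_def superlevel_def\<close>)
  also have "\<dots> = z"
    using assms by (simp, intro act_one) (auto simp: vr_lists_def superlevel_def)
  finally have "vr_boundary (act g c) = z"
    by (simp add: vr_boundary_push c)
  moreover have "Poly_Mapping.keys (act g c) \<subseteq> vr_lists (superlevel (\<chi> g)) d (K (Suc q)) (Suc (Suc q))"
    using keys_act_superlevel[OF \<open>g \<in> carrier G\<close> c(1)] by simp
  ultimately have "\<exists>c. Poly_Mapping.keys c \<subseteq> vr_lists (superlevel (\<chi> g)) d (K (Suc q)) (Suc (Suc q)) \<and>
     vr_boundary c = z"
    by blast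
  from someI_ex[OF this] show
    "Poly_Mapping.keys (fill q (\<chi> g) z) \<subseteq> vr_lists (superlevel (\<chi> g)) d (K (Suc q)) (Suc (Suc q))"
    "vr_boundary (fill q (\<chi> g) z) = z"
    unfolding fill_def by auto
qed

text \<open>Right multiplication by t commutes with left translation and shifts
  \<open>\<chi>\<close> by \<open>\<chi> t\<close>. In higher degrees the filling is chosen for the
  normalized simplex and carried back by the first vertex, which forces equivariance.\<close>

primrec raise :: "nat \<Rightarrow> 'a list \<Rightarrow> ('a list \<Rightarrow>\<^sub>0 int)" where
  "raise 0 \<sigma> = frag_of (map (\<lambda>x. x \<otimes> t) \<sigma>)"
| "raise (Suc q) \<sigma> = act (hd \<sigma>) (fill q (Min (\<chi> ` set (normalize \<sigma>)) + \<chi> t)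
     (frag_extend (raise q) (vr_boundary (frag_of (normalize \<sigma>)))))"

text \<open>The three properties need one joint induction: to fill in the next degree, the image of
  the boundary must be a cycle at the right level and scale, and equivariance identifies the
  boundary after translating back. Every degree gains the full amount
  \<open>\<chi> t\<close>.\<close>

lemma raise_properties:
  assumes "q \<le> m" "length \<sigma> = Suc q" "set \<sigma> \<subseteq> carrier G"
  shows "(\<forall>r. set \<sigma> \<subseteq> superlevel r \<longrightarrow>
        Poly_Mapping.keys (raise q \<sigma>) \<subseteq> vr_lists (superlevel (r + \<chi> t)) d (K q) (Suc q)) \<and>
      (\<forall>g\<in>carrier G. raise q (map (\<lambda>x. g \<otimes> x) \<sigma>) = act g (raise q \<sigma>)) \<and>
      vr_boundary (raise q \<sigma>) =
        (if q = 0 then frag_of [] else frag_extend (raise (q - 1)) (vr_boundary (frag_of \<sigma>)))"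
  using assms
proof (induction q arbitrary: \<sigma>)
  case 0
  then show ?case
    using K_nonneg[of 0] t
    by (auto simp: length_Suc_conv vr_lists_def superlevel_def character_mult dist_self m_assoc)
next
  case (Suc q)
  define b where "b \<tau> = fill q (Min (\<chi> ` set \<tau>) + \<chi> t) (frag_extend (raise q) (vr_boundary (frag_of \<tau>)))" for \<tau>
  have raise_Suc: "raise (Suc q) \<sigma> = act (hd \<sigma>) (b (normalize \<sigma>))" for \<sigma>
    by (simp add: b_def)
  have keys: "Poly_Mapping.keys (frag_extend (raise q) (vr_boundary (frag_of \<tau>)))
      \<subseteq> vr_lists (superlevel (r + \<chi> t)) d (K q) (Suc q)"
    if "length \<tau> = Suc (Suc q)" "set \<tau> \<subseteq> superlevel r" for \<tau> r
  proof (rule keys_frag_extend_subset[OF keys_vr_boundary])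
    fix \<rho> assume "\<rho> \<in> {ys. Suc (length ys) = length \<tau> \<and> set ys \<subseteq> set \<tau>}"
    then have "length \<rho> = Suc q" "set \<rho> \<subseteq> superlevel r" "set \<rho> \<subseteq> carrier G"
      using that superlevel_subset by auto
    then show "Poly_Mapping.keys (raise q \<rho>) \<subseteq> vr_lists (superlevel (r + \<chi> t)) d (K q) (Suc q)"
      using Suc.prems Suc.IH[of \<rho>] by simp
  qed
  have cycle: "vr_boundary (frag_extend (raise q) (vr_boundary (frag_of \<tau>))) = 0"
    if \<tau>: "length \<tau> = Suc (Suc q)" "set \<tau> \<subseteq> carrier G" for \<tau>
  proof -
    have faces: "length \<rho> = Suc q \<and> set \<rho> \<subseteq> carrier G"
      if "\<rho> \<in> Poly_Mapping.keys (vr_boundary (frag_of \<tau>))" for \<rho>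
      using that keys_vr_boundary[of \<tau>] \<tau> by auto
    have "vr_boundary (frag_extend (raise q) (vr_boundary (frag_of \<tau>))) =
        frag_extend (\<lambda>\<rho>. vr_boundary (raise q \<rho>)) (vr_boundary (frag_of \<tau>))"
      by (rule vr_boundary_extend)
    \<comment> \<open>In degree 0 a vertex and its image both have the empty list as boundary, so
      the expression is the double boundary of \<open>\<tau>\<close>; above it, the induction
      hypothesis produces a double boundary as well.\<close>
    also have "\<dots> = (if q = 0 then frag_extend (\<lambda>\<rho>. vr_boundary (frag_of \<rho>)) (vr_boundary (frag_of \<tau>))
        else frag_extend (raise (q - 1)) (vr_boundary (vr_boundary (frag_of \<tau>))))"
    proof (cases "q = 0")
      case True
      have "vr_boundary (raise q \<rho>) = vr_boundary (frag_of \<rho>)"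
        if "\<rho> \<in> Poly_Mapping.keys (vr_boundary (frag_of \<tau>))" for \<rho>
        using faces[OF that] True by (auto simp: length_Suc_conv)
      then show ?thesis
        using True by (simp cong: frag_extend_eq)
    next
      case False
      have "vr_boundary (raise q \<rho>) = frag_extend (raise (q - 1)) (vr_boundary (frag_of \<rho>))"
        if "\<rho> \<in> Poly_Mapping.keys (vr_boundary (frag_of \<tau>))" for \<rho>
        using faces[OF that] False Suc.prems Suc.IH[of \<rho>] by simp
      then have "frag_extend (\<lambda>\<rho>. vr_boundary (raise q \<rho>)) (vr_boundary (frag_of \<tau>)) =
          frag_extend (\<lambda>\<rho>. frag_extend (raise (q - 1)) (vr_boundary (frag_of \<rho>))) (vr_boundary (frag_of \<tau>))"
        by (rule frag_extend_eq)
      then show ?thesis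
        using False by (subst frag_extend_vr_boundary[of _ "vr_boundary (frag_of \<tau>)"]) simp
    qed
    also have "\<dots> = 0"
      using vr_boundary_extend[of frag_of "vr_boundary (frag_of \<tau>)"]
      by (simp add: frag_expansion[symmetric])
    finally show ?thesis .
  qed
  have b: "Poly_Mapping.keys (b \<tau>) \<subseteq> vr_lists (superlevel (r + \<chi> t)) d (K (Suc q)) (Suc (Suc q))"
      "vr_boundary (b \<tau>) = frag_extend (raise q) (vr_boundary (frag_of \<tau>))"
    if \<tau>: "length \<tau> = Suc (Suc q)" "set \<tau> \<subseteq> superlevel r" for \<tau> r
  proof -
    \<comment> \<open>The minimum is attained at a vertex y, so the level used by \<open>b\<close>
      equals \<open>\<chi> (y \<otimes> t)\<close>, a value of \<open>\<chi>\<close>, as the filling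
      lemma requires.\<close>
    have "Min (\<chi> ` set \<tau>) \<in> \<chi> ` set \<tau>"
      using \<tau> by (intro Min_in) auto
    then obtain y where y: "y \<in> set \<tau>" "Min (\<chi> ` set \<tau>) = \<chi> y"
      by auto
    have G: "set \<tau> \<subseteq> carrier G"
      using \<tau> superlevel_subset by blast
    then have yt: "y \<otimes> t \<in> carrier G" "\<chi> y + \<chi> t = \<chi> (y \<otimes> t)"
      using y t by (auto simp: character_mult)
    have "\<chi> y \<le> \<chi> x" if "x \<in> set \<tau>" for x
      using that y(2) Min_le[of "\<chi> ` set \<tau>" "\<chi> x"] by simp
    then have "set \<tau> \<subseteq> superlevel (\<chi> y)"
      using G by (auto simp: superlevel_def)
    from keys[OF \<tau>(1) this] have
      *: "Poly_Mapping.keys (frag_extend (raise q) (vr_boundary (frag_of \<tau>)))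
        \<subseteq> vr_lists (superlevel (\<chi> (y \<otimes> t))) d (K q) (Suc q)"
      by (simp add: yt)
    have "q < m"
      using Suc.prems by simp
    note fill = fill[OF this yt(1) * cycle[OF \<tau>(1) G]]
    have "r \<le> \<chi> y"
      using y(1) \<tau> by (auto simp: superlevel_def)
    then have "superlevel (\<chi> (y \<otimes> t)) \<subseteq> superlevel (r + \<chi> t)"
      by (intro superlevel_antimono) (simp flip: yt(2))
    from fill(1) vr_lists_mono[OF this order_refl]
    show "Poly_Mapping.keys (b \<tau>) \<subseteq> vr_lists (superlevel (r + \<chi> t)) d (K (Suc q)) (Suc (Suc q))"
      unfolding b_def y(2) yt(2) by blast
    show "vr_boundary (b \<tau>) = frag_extend (raise q) (vr_boundary (frag_of \<tau>))"
      unfolding b_def y(2) yt(2) by (rule fill(2))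
  qed
  have G: "hd \<sigma> \<in> carrier G" "set (normalize \<sigma>) \<subseteq> carrier G"
    using Suc.prems hd_in_carrier[of \<sigma>] normalize_carrier by (cases "\<sigma> = []"; simp)+
  have normal: "set (normalize \<sigma>) \<subseteq> superlevel (Min (\<chi> ` set (normalize \<sigma>)))"
    using G by (auto simp: superlevel_def)
  have "Poly_Mapping.keys (raise (Suc q) \<sigma>)
      \<subseteq> vr_lists (superlevel (r + \<chi> t)) d (K (Suc q)) (Suc (Suc q))" if "set \<sigma> \<subseteq> superlevel r" for r
  proof -
    \<comment> \<open>Normalizing lowers the level by \<open>\<chi> (hd \<sigma>)\<close>, and
      translating the filling back restores it.\<close>
    have "set (normalize \<sigma>) \<subseteq> superlevel (r - \<chi> (hd \<sigma>))"
      using map_mult_superlevel[of "inv (hd \<sigma>)" \<sigma> r] that G by (simp add: normalize_def)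
    then have "Poly_Mapping.keys (b (normalize \<sigma>))
        \<subseteq> vr_lists (superlevel (r - \<chi> (hd \<sigma>) + \<chi> t)) d (K (Suc q)) (Suc (Suc q))"
      using Suc.prems by (intro b) auto
    from keys_act_superlevel[OF G(1) this] show ?thesis
      unfolding raise_Suc by (simp add: algebra_simps)
  qed
  moreover have "raise (Suc q) (map (\<lambda>x. g \<otimes> x) \<sigma>) = act g (raise (Suc q) \<sigma>)" if "g \<in> carrier G" for g
  proof -
    have "normalize (map (\<lambda>x. g \<otimes> x) \<sigma>) = normalize \<sigma>"
      using normalize_map_mult that Suc.prems by auto
    moreover have "Poly_Mapping.keys (b (normalize \<sigma>)) \<subseteq>
        vr_lists (superlevel (Min (\<chi> ` set (normalize \<sigma>)) + \<chi> t)) d (K (Suc q)) (Suc (Suc q))"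
      using normal Suc.prems by (intro b) auto
    then have "set \<rho> \<subseteq> carrier G" if "\<rho> \<in> Poly_Mapping.keys (b (normalize \<sigma>))" for \<rho>
      using that superlevel_subset by (fastforce simp: vr_lists_def)
    moreover have "hd (map (\<lambda>x. g \<otimes> x) \<sigma>) = g \<otimes> hd \<sigma>"
      using Suc.prems by (intro hd_map) auto
    ultimately show ?thesis
      unfolding raise_Suc using that G act_act[of g "hd \<sigma>" "b (normalize \<sigma>)"] by simp
  qed
  moreover have "vr_boundary (raise (Suc q) \<sigma>) = frag_extend (raise q) (vr_boundary (frag_of \<sigma>))"
  proof -
    have "vr_boundary (b (normalize \<sigma>)) =
        frag_extend (raise q) (vr_boundary (frag_of (normalize \<sigma>)))"
      using normal Suc.prems by (intro b) auto
    then have "vr_boundary (raise (Suc q) \<sigma>) =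
        frag_extend (\<lambda>\<rho>. act (hd \<sigma>) (raise q \<rho>)) (vr_boundary (frag_of (normalize \<sigma>)))"
      by (simp only: raise_Suc vr_boundary_push push_extend)
    also have "\<dots> = frag_extend (\<lambda>\<rho>. raise q (map (\<lambda>x. hd \<sigma> \<otimes> x) \<rho>)) (vr_boundary (frag_of (normalize \<sigma>)))"
    proof (rule frag_extend_eq)
      fix \<rho> assume "\<rho> \<in> Poly_Mapping.keys (vr_boundary (frag_of (normalize \<sigma>)))"
      then have "length \<rho> = Suc q" "set \<rho> \<subseteq> carrier G"
        using keys_vr_boundary[of "normalize \<sigma>"] Suc.prems G by auto
      then show "act (hd \<sigma>) (raise q \<rho>) = raise q (map (\<lambda>x. hd \<sigma> \<otimes> x) \<rho>)"
        using Suc.IH[of \<rho>] Suc.prems G by simp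
    qed
    also have "\<dots> = frag_extend (raise q) (vr_boundary (act (hd \<sigma>) (frag_of (normalize \<sigma>))))"
      by (simp only: vr_boundary_push extend_push)
    finally show ?thesis
      using Suc.prems by (simp add: map_hd_normalize del: raise.simps)
  qed
  ultimately show ?case
    by (simp del: raise.simps)
qed

end


section \<open>Module structure and valuation of chain maps\<close>

lemma valuation_ge:
  assumes "\<And>\<sigma>. \<sigma> \<in> Poly_Mapping.keys c \<Longrightarrow> \<sigma> \<noteq> []"
    and "\<And>\<sigma> x. \<sigma> \<in> Poly_Mapping.keys c \<Longrightarrow> x \<in> set \<sigma> \<Longrightarrow> r \<le> \<chi> x"
  shows "ereal r \<le> valuation \<chi> c"
  unfolding valuation_def using assms by (intro INF_greatest) auto

text \<open>The support is finite and non-empty, so the infimum is a minimum.\<close>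

lemma valuation_attained:
  assumes "c \<noteq> 0"
  obtains \<sigma> where "\<sigma> \<in> Poly_Mapping.keys c" "valuation \<chi> c = ereal (Min (\<chi> ` set \<sigma>))"
proof -
  let ?V = "(\<lambda>\<sigma>. ereal (Min (\<chi> ` set \<sigma>))) ` Poly_Mapping.keys c"
  have V: "finite ?V" "?V \<noteq> {}"
    using assms by auto
  have "valuation \<chi> c = Min ?V"
    unfolding valuation_def by (rule Min_Inf[OF V, symmetric])
  with Min_in[OF V] that show ?thesis
    by fastforce
qed

lemma valuation_le:
  assumes "\<sigma> \<in> Poly_Mapping.keys c" "x \<in> set \<sigma>"
  shows "valuation \<chi> c \<le> ereal (\<chi> x)"
proof -
  have "valuation \<chi> c \<le> ereal (Min (\<chi> ` set \<sigma>))"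
    unfolding valuation_def by (rule INF_lower[OF assms(1)])
  also have "\<dots> \<le> ereal (\<chi> x)"
    using assms(2) by simp
  finally show ?thesis .
qed

text \<open>The infinite value of \<open>a\<close> covers chains that the endomorphism sends to
  zero.\<close>

lemma ereal_less_diff:
  assumes "ereal r < a"
  shows "0 < a - ereal r"
  using assms by (cases a) auto

context metric_group_character
begin

lemma group_ring_act_eq: "group_ring_act G a c = frag_extend (\<lambda>g. act g c) a"
  by (simp add: group_ring_act_def push_def)

text \<open>Linearity over the group ring reduces to single group elements acting on single
  simplices.\<close>

lemma extend_group_ring_act:
  assumes "Poly_Mapping.keys a \<subseteq> carrier G"
    and "\<And>g \<sigma>. g \<in> carrier G \<Longrightarrow> \<sigma> \<in> Poly_Mapping.keys c \<Longrightarrow> f (map (\<lambda>x. g \<otimes> x) \<sigma>) = act g (f \<sigma>)"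
  shows "frag_extend f (group_ring_act G a c) = group_ring_act G a (frag_extend f c)"
  unfolding group_ring_act_eq frag_extend_frag_extend
proof (rule frag_extend_eq)
  fix g assume "g \<in> Poly_Mapping.keys a"
  with assms(1) have "g \<in> carrier G"
    by blast
  then show "frag_extend f (act g c) = act g (frag_extend f c)"
    unfolding extend_push push_extend by (intro frag_extend_eq assms(2))
qed

end

lemma (in filled_halfspace) raise_chain_endo:
  assumes k: "K m \<le> k" and t_pos: "0 < \<chi> t"
  defines "\<phi> \<equiv> \<lambda>q. frag_extend (raise q)"
  shows "group_ring_chain_endo G d k m \<phi>" "extends_identity G d k \<phi>"
    and "\<And>q c. q \<le> m \<Longrightarrow> c \<in> carrier (vr_chains (carrier G) d k q) \<Longrightarrow> c \<noteq> 0 \<Longrightarrow>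
      valuation \<chi> (\<phi> q c) - valuation \<chi> c > 0"
proof -
  have simplex: "length \<sigma> = Suc q" "set \<sigma> \<subseteq> carrier G"
    if "c \<in> carrier (vr_chains (carrier G) d k q)" "\<sigma> \<in> Poly_Mapping.keys c" for c q \<sigma>
    using that by (auto simp: carrier_vr_chains vr_lists_def)
  \<comment> \<open>The scales increase with the degree, so \<open>K m \<le> k\<close> accommodates
    all degrees up to m at once.\<close>
  have K: "K q \<le> k" if "q \<le> m" for q
    using lift_Suc_mono_le[of K, OF K_step that] k by simp
  have keys: "Poly_Mapping.keys (\<phi> q c) \<subseteq> vr_lists (superlevel (r + \<chi> t)) d k (Suc q)"
    if "q \<le> m" "c \<in> carrier (vr_chains (carrier G) d k q)"
      "\<And>\<sigma>. \<sigma> \<in> Poly_Mapping.keys c \<Longrightarrow> set \<sigma> \<subseteq> superlevel r" for q c r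
    unfolding \<phi>_def
  proof (rule keys_frag_extend_subset[OF subset_refl])
    fix \<sigma> assume \<sigma>: "\<sigma> \<in> Poly_Mapping.keys c"
    have "Poly_Mapping.keys (raise q \<sigma>) \<subseteq> vr_lists (superlevel (r + \<chi> t)) d (K q) (Suc q)"
      using raise_properties[OF that(1) simplex[OF that(2) \<sigma>]] that(3)[OF \<sigma>] by blast
    with vr_lists_mono[OF subset_refl K[OF that(1)]]
    show "Poly_Mapping.keys (raise q \<sigma>) \<subseteq> vr_lists (superlevel (r + \<chi> t)) d k (Suc q)"
      by blast
  qed
  have closed: "\<phi> q c \<in> carrier (vr_chains (carrier G) d k q)"
    if q: "q \<le> m" and c: "c \<in> carrier (vr_chains (carrier G) d k q)" for q c
  proof -
    have "Poly_Mapping.keys (raise q \<sigma>) \<subseteq> vr_lists (carrier G) d k (Suc q)"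
      if \<sigma>: "\<sigma> \<in> Poly_Mapping.keys c" for \<sigma>
    proof -
      have "set \<sigma> \<subseteq> superlevel (Min (\<chi> ` set \<sigma>))"
        using simplex[OF c \<sigma>] by (auto simp: superlevel_def)
      then have "Poly_Mapping.keys (raise q \<sigma>) \<subseteq> vr_lists (superlevel (Min (\<chi> ` set \<sigma>) + \<chi> t)) d (K q) (Suc q)"
        using raise_properties[OF q simplex[OF c \<sigma>]] by blast
      with vr_lists_mono[OF superlevel_subset K[OF q]] show ?thesis
        by blast
    qed
    then show ?thesis
      unfolding \<phi>_def carrier_vr_chains by (rule keys_frag_extend_subset[OF subset_refl])
  qed
  have "\<phi> q \<in> hom (vr_chains (carrier G) d k q) (vr_chains (carrier G) d k q)" if "q \<le> m" for q
    using closed[OF that] by (auto simp: hom_def \<phi>_def vr_chains_def frag_extend_add)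
  moreover have "\<phi> q (group_ring_act G a c) = group_ring_act G a (\<phi> q c)"
    if "q \<le> m" "a \<in> carrier (free_Abelian_group (carrier G))" "c \<in> carrier (vr_chains (carrier G) d k q)" for q a c
    unfolding \<phi>_def
  proof (rule extend_group_ring_act)
    show "raise q (map (\<lambda>x. g \<otimes> x) \<sigma>) = act g (raise q \<sigma>)"
      if "g \<in> carrier G" "\<sigma> \<in> Poly_Mapping.keys c" for g \<sigma>
      using raise_properties[OF \<open>q \<le> m\<close> simplex[OF _ that(2)]] that(1)
        \<open>c \<in> carrier (vr_chains (carrier G) d k q)\<close> by blast
  qed (use that in auto)
  moreover have "vr_boundary (\<phi> (Suc q) c) = \<phi> q (vr_boundary c)"
    if "q < m" "c \<in> carrier (vr_chains (carrier G) d k (Suc q))" for q c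
    unfolding \<phi>_def vr_boundary_extend frag_extend_vr_boundary[of _ c]
  proof (rule frag_extend_eq)
    fix \<sigma> assume "\<sigma> \<in> Poly_Mapping.keys c"
    with raise_properties[of "Suc q" \<sigma>] simplex[OF that(2)] \<open>q < m\<close>
    show "vr_boundary (raise (Suc q) \<sigma>) = frag_extend (raise q) (vr_boundary (frag_of \<sigma>))"
      by (simp del: raise.simps)
  qed
  ultimately show "group_ring_chain_endo G d k m \<phi>"
    by (simp add: group_ring_chain_endo_def)
  show "extends_identity G d k \<phi>"
    unfolding extends_identity_def
  proof
    fix c assume c: "c \<in> carrier (vr_chains (carrier G) d k 0)"
    have "vr_boundary (\<phi> 0 c) = frag_extend (\<lambda>\<sigma>. vr_boundary (frag_of \<sigma>)) c"
      unfolding \<phi>_def vr_boundary_extend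
    proof (rule frag_extend_eq)
      fix \<sigma> assume "\<sigma> \<in> Poly_Mapping.keys c"
      then obtain x where "\<sigma> = [x]"
        using simplex(1)[OF c] by (auto simp: length_Suc_conv)
      then show "vr_boundary (raise 0 \<sigma>) = vr_boundary (frag_of \<sigma>)"
        by simp
    qed
    also have "\<dots> = vr_boundary c"
      using vr_boundary_extend[of frag_of c] frag_expansion[of c] by simp
    finally have "vr_boundary (\<phi> 0 c) = vr_boundary c" .
    moreover have "length xs = 1" if "xs \<in> Poly_Mapping.keys c \<union> Poly_Mapping.keys (\<phi> 0 c)" for xs
      using that simplex(1)[OF c] simplex(1)[OF closed[OF _ c]] by auto
    ultimately have "frag_cmul (augmentation (\<phi> 0 c)) (frag_of []) = frag_cmul (augmentation c) (frag_of ([] :: 'a list))"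
      using vr_boundary_augmentation[of c] vr_boundary_augmentation[of "\<phi> 0 c"] by simp
    \<comment> \<open>The augmentation is the coefficient of the empty list in the boundary.\<close>
    from arg_cong[OF this, of "\<lambda>z. Poly_Mapping.lookup z []"]
    show "augmentation (\<phi> 0 c) = augmentation c"
      by simp
  qed
  fix q c assume q: "q \<le> m" and c: "c \<in> carrier (vr_chains (carrier G) d k q)" and "c \<noteq> 0"
  then obtain \<rho> where \<rho>: "\<rho> \<in> Poly_Mapping.keys c" "valuation \<chi> c = ereal (Min (\<chi> ` set \<rho>))"
    using valuation_attained by blast
  have "set \<sigma> \<subseteq> superlevel (Min (\<chi> ` set \<rho>))" if "\<sigma> \<in> Poly_Mapping.keys c" for \<sigma>
    using simplex(2)[OF c that] valuation_le[OF that, of _ \<chi>] \<rho>(2) by (auto simp: superlevel_def)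
  from keys[OF q c this] have keys_\<phi>: "Poly_Mapping.keys (\<phi> q c) \<subseteq>
      vr_lists (superlevel (Min (\<chi> ` set \<rho>) + \<chi> t)) d k (Suc q)" .
  have "ereal (Min (\<chi> ` set \<rho>)) < ereal (Min (\<chi> ` set \<rho>) + \<chi> t)"
    using t_pos by simp
  also have "\<dots> \<le> valuation \<chi> (\<phi> q c)"
    by (rule valuation_ge) (use keys_\<phi> in \<open>fastforce simp: vr_lists_def superlevel_def\<close>)+
  finally show "valuation \<chi> (\<phi> q c) - valuation \<chi> c > 0"
    unfolding \<rho>(2) by (rule ereal_less_diff)
qed

section \<open>From a valuation-increasing chain map to fillings in the half space\<close>

text \<open>The map \<open>f n\<close> acts on simplices with \<open>n\<close> vertices, \<open>f 0\<close> being the identity on the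
  augmentation module.\<close>

locale raising_chain_map = metric_group_character G d \<chi>
  for G :: "('a, 'b) monoid_scheme" (structure) and d \<chi> +
  fixes f :: "nat \<Rightarrow> 'a list \<Rightarrow> ('a list \<Rightarrow>\<^sub>0 int)" and l :: real and m :: nat
  assumes f_Nil: "f 0 [] = frag_of []"
    and f_keys: "n \<le> Suc m \<Longrightarrow> \<sigma> \<in> vr_lists (carrier G) d l n \<Longrightarrow>
      Poly_Mapping.keys (f n \<sigma>) \<subseteq> vr_lists (carrier G) d l n"
    and f_mult: "n \<le> Suc m \<Longrightarrow> \<sigma> \<in> vr_lists (carrier G) d l n \<Longrightarrow> g \<in> carrier G \<Longrightarrow>
      f n (map (\<lambda>x. g \<otimes> x) \<sigma>) = act g (f n \<sigma>)"
    and f_boundary: "n \<le> m \<Longrightarrow> \<sigma> \<in> vr_lists (carrier G) d l (Suc n) \<Longrightarrow>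
      vr_boundary (f (Suc n) \<sigma>) = frag_extend (f n) (vr_boundary (frag_of \<sigma>))"
    and f_raise: "n \<le> m \<Longrightarrow> \<sigma> \<in> vr_lists (carrier G) d l (Suc n) \<Longrightarrow>
      \<tau> \<in> Poly_Mapping.keys (f (Suc n) \<sigma>) \<Longrightarrow> x \<in> set \<tau> \<Longrightarrow> Min (\<chi> ` set \<sigma>) < \<chi> x"
begin

text \<open>The gain is bounded away from zero because there are only finitely many orbits of simplices.\<close>

lemma uniform_raise:
  assumes n: "n \<le> m"
  obtains \<epsilon> where "\<epsilon> > 0"
    "\<And>r \<sigma>. \<sigma> \<in> vr_lists (superlevel r) d l (Suc n) \<Longrightarrow>
      Poly_Mapping.keys (f (Suc n) \<sigma>) \<subseteq> vr_lists (superlevel (r + \<epsilon>)) d l (Suc n)"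
proof -
  let ?R = "{\<rho> \<in> vr_lists (carrier G) d l (Suc n). hd \<rho> = \<one>}"
  define A where "A = (\<Union>\<rho>\<in>?R. \<Union>\<tau>\<in>Poly_Mapping.keys (f (Suc n) \<rho>). \<Union>x\<in>set \<tau>. {\<chi> x - Min (\<chi> ` set \<rho>)})"
  \<comment> \<open>The gains on representatives may form an empty set, if the map vanishes on all
    of them; inserting 1 keeps the minimum defined and positive.\<close>
  define \<epsilon> where "\<epsilon> = Min (insert 1 A)"
  have fin: "finite (insert 1 A)"
    unfolding A_def using finite_orbit_representatives by auto
  have pos: "0 < a" if "a \<in> insert 1 A" for a
    using that f_raise[OF n] by (auto simp: A_def)
  have rep: "Poly_Mapping.keys (f (Suc n) \<rho>) \<subseteq> vr_lists (superlevel (r + \<epsilon>)) d l (Suc n)"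
    if \<rho>: "\<rho> \<in> ?R" "set \<rho> \<subseteq> superlevel r" for \<rho> r
  proof
    fix \<tau> assume \<tau>: "\<tau> \<in> Poly_Mapping.keys (f (Suc n) \<rho>)"
    then have G: "\<tau> \<in> vr_lists (carrier G) d l (Suc n)"
      using f_keys[of "Suc n" \<rho>] n \<rho> by auto
    have "\<rho> \<noteq> []"
      using \<rho>(1) by (auto simp: vr_lists_def)
    then have r: "r \<le> Min (\<chi> ` set \<rho>)"
      using \<rho>(2) by (auto simp: superlevel_def)
    have "r + \<epsilon> \<le> \<chi> x" if "x \<in> set \<tau>" for x
    proof -
      have "\<chi> x - Min (\<chi> ` set \<rho>) \<in> A"
        unfolding A_def using \<rho>(1) \<tau> that by blast
      then have "\<epsilon> \<le> \<chi> x - Min (\<chi> ` set \<rho>)"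
        unfolding \<epsilon>_def using fin by (intro Min_le) auto
      with r show ?thesis
        by simp
    qed
    with G show "\<tau> \<in> vr_lists (superlevel (r + \<epsilon>)) d l (Suc n)"
      by (auto simp: vr_lists_def superlevel_def)
  qed
  show ?thesis
  proof (rule that)
    show "\<epsilon> > 0"
      unfolding \<epsilon>_def using fin pos by (subst Min_gr_iff) auto
    fix r \<sigma> assume \<sigma>: "\<sigma> \<in> vr_lists (superlevel r) d l (Suc n)"
    then have G: "\<sigma> \<in> vr_lists (carrier G) d l (Suc n)"
      using vr_lists_superlevel_subset by blast
    then have \<sigma>': "set \<sigma> \<subseteq> carrier G" "\<sigma> \<noteq> []"
      by (auto simp: vr_lists_def)
    then have h: "hd \<sigma> \<in> carrier G"
      using hd_in_carrier by blast
    have norm: "normalize \<sigma> \<in> ?R"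
      by (rule normalize_vr_lists[OF G])
    \<comment> \<open>Translation shifts the levels of a simplex and of its image equally, so the
      gain of the representative is the gain of \<open>\<sigma>\<close>.\<close>
    have "set (normalize \<sigma>) \<subseteq> superlevel (r - \<chi> (hd \<sigma>))"
      using map_mult_superlevel[of "inv (hd \<sigma>)" \<sigma> r] h \<sigma> by (simp add: normalize_def vr_lists_def)
    from keys_act_superlevel[OF h rep[OF norm this]]
    have "Poly_Mapping.keys (act (hd \<sigma>) (f (Suc n) (normalize \<sigma>))) \<subseteq> vr_lists (superlevel (r + \<epsilon>)) d l (Suc n)"
      by simp
    moreover have "f (Suc n) \<sigma> = act (hd \<sigma>) (f (Suc n) (normalize \<sigma>))"
      using f_mult[of "Suc n" "normalize \<sigma>", OF _ _ h] n norm by (simp add: map_hd_normalize[OF \<sigma>'(1)])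
    ultimately show "Poly_Mapping.keys (f (Suc n) \<sigma>) \<subseteq> vr_lists (superlevel (r + \<epsilon>)) d l (Suc n)"
      by simp
  qed
qed

lemma extend_keys:
  assumes "n \<le> m" "Poly_Mapping.keys c \<subseteq> vr_lists (superlevel r) d l (Suc n)"
  shows "Poly_Mapping.keys (frag_extend (f (Suc n)) c) \<subseteq> vr_lists (superlevel r) d l (Suc n)"
proof (rule keys_frag_extend_subset[OF assms(2)])
  fix \<sigma> assume \<sigma>: "\<sigma> \<in> vr_lists (superlevel r) d l (Suc n)"
  obtain \<epsilon> where "\<epsilon> > 0" "Poly_Mapping.keys (f (Suc n) \<sigma>) \<subseteq> vr_lists (superlevel (r + \<epsilon>)) d l (Suc n)"
    using uniform_raise[OF assms(1)] \<sigma> by metis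
  with vr_lists_mono[OF superlevel_antimono[of r "r + \<epsilon>"] order_refl]
  show "Poly_Mapping.keys (f (Suc n) \<sigma>) \<subseteq> vr_lists (superlevel r) d l (Suc n)"
    by force
qed

lemma iterate_keys:
  assumes "n \<le> m" "Poly_Mapping.keys c \<subseteq> vr_lists (superlevel r) d l (Suc n)"
  shows "Poly_Mapping.keys ((frag_extend (f (Suc n)) ^^ s) c) \<subseteq> vr_lists (superlevel r) d l (Suc n)"
  by (induction s) (simp_all add: assms extend_keys)

text \<open>A chain has finite support, hence a lowest level r, and s iterations raise it to at
  least \<open>r + real s * \<epsilon>\<close>. Gains that are merely positive could be summable;
  the uniform \<open>\<epsilon>\<close> rules this out.\<close>

lemma iterate_into_halfspace:
  assumes n: "n \<le> m" and c: "Poly_Mapping.keys c \<subseteq> vr_lists (carrier G) d l (Suc n)"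
  obtains s where "Poly_Mapping.keys ((frag_extend (f (Suc n)) ^^ s) c) \<subseteq> vr_lists (superlevel 0) d l (Suc n)"
proof -
  obtain \<epsilon> where \<epsilon>: "\<epsilon> > 0" "\<And>r \<sigma>. \<sigma> \<in> vr_lists (superlevel r) d l (Suc n) \<Longrightarrow>
      Poly_Mapping.keys (f (Suc n) \<sigma>) \<subseteq> vr_lists (superlevel (r + \<epsilon>)) d l (Suc n)"
    using uniform_raise[OF n] by metis
  define A where "A = \<chi> ` (\<Union>\<sigma>\<in>Poly_Mapping.keys c. set \<sigma>)"
  define r where "r = Min (insert 0 A)"
  have "r \<le> \<chi> x" if "\<sigma> \<in> Poly_Mapping.keys c" "x \<in> set \<sigma>" for \<sigma> x
    unfolding r_def by (rule Min_le) (use that in \<open>auto simp: A_def\<close>)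
  with c have r: "Poly_Mapping.keys c \<subseteq> vr_lists (superlevel r) d l (Suc n)"
    by (auto simp: vr_lists_def superlevel_def)
  have iter: "Poly_Mapping.keys ((frag_extend (f (Suc n)) ^^ s) c)
      \<subseteq> vr_lists (superlevel (r + real s * \<epsilon>)) d l (Suc n)" for s
  proof (induction s)
    case (Suc s)
    have "Poly_Mapping.keys (frag_extend (f (Suc n)) ((frag_extend (f (Suc n)) ^^ s) c))
        \<subseteq> vr_lists (superlevel (r + real s * \<epsilon> + \<epsilon>)) d l (Suc n)"
      by (rule keys_frag_extend_subset[OF Suc \<epsilon>(2)])
    then show ?case
      by (simp add: algebra_simps)
  qed (use r in simp)
  obtain s :: nat where "- r < real s * \<epsilon>"
    using reals_Archimedean3[OF \<epsilon>(1)] by blast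
  then have "superlevel (r + real s * \<epsilon>) \<subseteq> superlevel 0"
    by (intro superlevel_antimono) simp
  from that iter[of s] vr_lists_mono[OF this order_refl] show ?thesis
    by blast
qed

lemma extend_boundary:
  assumes "n \<le> m" "Poly_Mapping.keys c \<subseteq> vr_lists (carrier G) d l (Suc n)"
  shows "vr_boundary (frag_extend (f (Suc n)) c) = frag_extend (f n) (vr_boundary c)"
  unfolding vr_boundary_extend frag_extend_vr_boundary[of _ c]
  by (rule frag_extend_eq) (use assms f_boundary in blast)

text \<open>Coning off from a vertex of the simplex never lowers the valuation, so \<open>f\<close> is homotopic to
  the identity inside every superlevel set, at the price of a larger scale.\<close>

primrec homotopy :: "nat \<Rightarrow> 'a list \<Rightarrow> ('a list \<Rightarrow>\<^sub>0 int)" where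
  "homotopy 0 \<sigma> = 0"
| "homotopy (Suc n) \<sigma> = cone (hd \<sigma>)
     (f (Suc n) \<sigma> - frag_of \<sigma> - frag_extend (homotopy n) (vr_boundary (frag_of \<sigma>)))"

text \<open>The chain under the cone is a cycle, by the formula one degree lower, so the boundary of
  the cone returns it. At the bottom this says that the image of a vertex minus the vertex has
  augmentation zero.\<close>

lemma homotopy_boundary_simplex:
  assumes "n \<le> m" "\<sigma> \<in> vr_lists (carrier G) d l (Suc n)"
  shows "vr_boundary (homotopy (Suc n) \<sigma>) =
    f (Suc n) \<sigma> - frag_of \<sigma> - frag_extend (homotopy n) (vr_boundary (frag_of \<sigma>))"
  using assms
proof (induction n arbitrary: \<sigma>)
  case 0
  then obtain x where \<sigma>: "\<sigma> = [x]"
    by (auto simp: vr_lists_def length_Suc_conv)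
  have "vr_boundary (f (Suc 0) \<sigma>) = frag_of []"
    using f_boundary[OF 0] by (simp add: \<sigma> f_Nil)
  then show ?case
    by (simp add: \<sigma> vr_boundary_cone)
next
  case (Suc n)
  have \<sigma>: "Poly_Mapping.keys (vr_boundary (frag_of \<sigma>)) \<subseteq> vr_lists (carrier G) d l (Suc n)"
    using Suc.prems by (intro keys_vr_boundary_vr_lists) simp
  have "vr_boundary (frag_extend (homotopy (Suc n)) (vr_boundary (frag_of \<sigma>)))
      = frag_extend (\<lambda>\<tau>. f (Suc n) \<tau> - frag_of \<tau> - frag_extend (homotopy n) (vr_boundary (frag_of \<tau>)))
          (vr_boundary (frag_of \<sigma>))"
    unfolding vr_boundary_extend using \<sigma> Suc by (intro frag_extend_eq Suc.IH) auto
  also have "\<dots> = frag_extend (f (Suc n)) (vr_boundary (frag_of \<sigma>)) - vr_boundary (frag_of \<sigma>)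
      - frag_extend (homotopy n) (vr_boundary (vr_boundary (frag_of \<sigma>)))"
  proof -
    have "frag_extend (\<lambda>\<tau>. a \<tau> - b \<tau> - e \<tau>) c = frag_extend a c - frag_extend b c - frag_extend e c"
      for a b e :: "'a list \<Rightarrow> ('a list \<Rightarrow>\<^sub>0 int)" and c
      by (induction c rule: frag_induction[OF subset_UNIV]) (auto simp: frag_extend_diff)
    then show ?thesis
      unfolding frag_extend_vr_boundary[of _ "vr_boundary (frag_of \<sigma>)"] by (simp flip: frag_expansion)
  qed
  also have "\<dots> = frag_extend (f (Suc n)) (vr_boundary (frag_of \<sigma>)) - vr_boundary (frag_of \<sigma>)"
    by simp
  finally have "vr_boundary (f (Suc (Suc n)) \<sigma> - frag_of \<sigma>
      - frag_extend (homotopy (Suc n)) (vr_boundary (frag_of \<sigma>))) = 0"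
    using f_boundary[OF Suc.prems] by simp
  then show ?case
    by (subst homotopy.simps(2)) (simp add: vr_boundary_cone del: homotopy.simps vr_boundary_simps cone_simps(4))
qed

text \<open>All vertices come from \<open>\<sigma>\<close> and from values of f on
  \<open>\<sigma>\<close> and its faces, none of which lies below r. Distances are left open here,
  since coning may increase them.\<close>

lemma homotopy_keys:
  assumes "n \<le> m" "\<sigma> \<in> vr_lists (superlevel r) d l (Suc n)"
  shows "Poly_Mapping.keys (homotopy (Suc n) \<sigma>) \<subseteq> {\<tau>. length \<tau> = Suc (Suc n) \<and> set \<tau> \<subseteq> superlevel r}"
  using assms
proof (induction n arbitrary: \<sigma>)
  case 0
  then have "hd \<sigma> \<in> superlevel r" "homotopy (Suc 0) \<sigma> = cone (hd \<sigma>) (f (Suc 0) \<sigma> - frag_of \<sigma>)"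
    by (auto simp: vr_lists_def length_Suc_conv)
  moreover have "Poly_Mapping.keys (f (Suc 0) \<sigma> - frag_of \<sigma>) \<subseteq> vr_lists (superlevel r) d l (Suc 0)"
    using extend_keys[of 0 "frag_of \<sigma>"] 0 by (intro keys_diff_subset) auto
  then have "Poly_Mapping.keys (f (Suc 0) \<sigma> - frag_of \<sigma>) \<subseteq> {\<tau>. length \<tau> = Suc 0 \<and> set \<tau> \<subseteq> superlevel r}"
    unfolding vr_lists_def by blast
  ultimately show ?case
    by (simp only:, intro order_trans[OF keys_cone_subset]) fastforce
next
  case (Suc n)
  let ?A = "{\<tau>. length \<tau> = Suc (Suc n) \<and> set \<tau> \<subseteq> superlevel r}"
  have \<sigma>: "Poly_Mapping.keys (vr_boundary (frag_of \<sigma>)) \<subseteq> vr_lists (superlevel r) d l (Suc n)"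
    using Suc.prems by (intro keys_vr_boundary_vr_lists) simp
  have "Poly_Mapping.keys (frag_extend (homotopy (Suc n)) (vr_boundary (frag_of \<sigma>))) \<subseteq> ?A"
    by (rule keys_frag_extend_subset[OF \<sigma>]) (rule Suc.IH, use Suc.prems in auto)
  moreover have "Poly_Mapping.keys (f (Suc (Suc n)) \<sigma>) \<subseteq> ?A"
    using extend_keys[of "Suc n" "frag_of \<sigma>" r] Suc.prems by (auto simp: vr_lists_def)
  moreover have "Poly_Mapping.keys (frag_of \<sigma>) \<subseteq> ?A"
    using Suc.prems by (auto simp: vr_lists_def)
  ultimately have "Poly_Mapping.keys (f (Suc (Suc n)) \<sigma> - frag_of \<sigma>
      - frag_extend (homotopy (Suc n)) (vr_boundary (frag_of \<sigma>))) \<subseteq> ?A"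
    by (intro keys_diff_subset)
  moreover have "hd \<sigma> \<in> superlevel r"
    using Suc.prems hd_in_set[of \<sigma>] by (cases "\<sigma> = []") (auto simp: vr_lists_def)
  ultimately show ?case
    unfolding homotopy.simps(2)[of "Suc n"] by (intro order_trans[OF keys_cone_subset]) fastforce
qed

text \<open>The apex is the first vertex of the simplex, and first vertices move along with
  translations; a fixed apex would break equivariance.\<close>

lemma homotopy_mult:
  assumes "n \<le> Suc m" "\<sigma> \<in> vr_lists (carrier G) d l n" "g \<in> carrier G"
  shows "homotopy n (map (\<lambda>x. g \<otimes> x) \<sigma>) = act g (homotopy n \<sigma>)"
  using assms
proof (induction n arbitrary: \<sigma>)
  case (Suc n)
  have "\<sigma> \<noteq> []"
    using Suc.prems by (auto simp: vr_lists_def)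
  have "frag_extend (homotopy n) (vr_boundary (frag_of (map (\<lambda>x. g \<otimes> x) \<sigma>)))
      = frag_extend (\<lambda>\<tau>. homotopy n (map (\<lambda>x. g \<otimes> x) \<tau>)) (vr_boundary (frag_of \<sigma>))"
    by (simp only: push_simps(2)[symmetric] vr_boundary_push extend_push)
  also have "\<dots> = act g (frag_extend (homotopy n) (vr_boundary (frag_of \<sigma>)))"
    unfolding push_extend
  proof (intro frag_extend_eq Suc.IH)
    fix \<tau> assume "\<tau> \<in> Poly_Mapping.keys (vr_boundary (frag_of \<sigma>))"
    then show "\<tau> \<in> vr_lists (carrier G) d l n"
      using keys_vr_boundary_vr_lists[of "frag_of \<sigma>" "carrier G" d l n] Suc.prems by auto
  qed (use Suc.prems in auto)
  finally show ?case
    using f_mult[OF Suc.prems] \<open>\<sigma> \<noteq> []\<close> by (simp add: push_cone hd_map)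
qed simp

lemma homotopy_scale:
  assumes n: "n \<le> m"
  obtains j where "\<And>\<sigma> r. \<sigma> \<in> vr_lists (superlevel r) d l (Suc n) \<Longrightarrow>
    Poly_Mapping.keys (homotopy (Suc n) \<sigma>) \<subseteq> vr_lists (superlevel r) d j (Suc (Suc n))"
proof -
  let ?R = "{\<rho> \<in> vr_lists (carrier G) d l (Suc n). hd \<rho> = \<one>}"
  define A where "A = (\<Union>\<rho>\<in>?R. \<Union>\<tau>\<in>Poly_Mapping.keys (homotopy (Suc n) \<rho>). \<Union>x\<in>set \<tau>. \<Union>y\<in>set \<tau>. {d x y})"
  \<comment> \<open>The largest distance between vertices of simplices occurring in the homotopy on
    representatives; left invariance extends the bound to whole orbits.\<close>
  define j where "j = Max (insert 0 A)"
  have fin: "finite (insert 0 A)"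
    unfolding A_def using finite_orbit_representatives by auto
  have rep: "Poly_Mapping.keys (homotopy (Suc n) \<rho>) \<subseteq> vr_lists (carrier G) d j (Suc (Suc n))"
    if \<rho>: "\<rho> \<in> ?R" for \<rho>
  proof
    fix \<tau> assume \<tau>: "\<tau> \<in> Poly_Mapping.keys (homotopy (Suc n) \<rho>)"
    have "\<rho> \<in> vr_lists (superlevel (Min (\<chi> ` set \<rho>))) d l (Suc n)"
      using \<rho> by (auto simp: vr_lists_def superlevel_def)
    from homotopy_keys[OF n this] \<tau> have "length \<tau> = Suc (Suc n)" "set \<tau> \<subseteq> carrier G"
      using superlevel_subset by blast+
    moreover have "d x y \<le> j" if "x \<in> set \<tau>" "y \<in> set \<tau>" for x y
      unfolding j_def using \<rho> \<tau> that by (intro Max_ge[OF fin]) (unfold A_def, blast)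
    ultimately show "\<tau> \<in> vr_lists (carrier G) d j (Suc (Suc n))"
      by (simp add: vr_lists_def)
  qed
  show ?thesis
  proof (rule that)
    fix \<sigma> r assume \<sigma>: "\<sigma> \<in> vr_lists (superlevel r) d l (Suc n)"
    then have G: "\<sigma> \<in> vr_lists (carrier G) d l (Suc n)"
      using vr_lists_superlevel_subset by blast
    then have \<sigma>': "set \<sigma> \<subseteq> carrier G" "\<sigma> \<noteq> []"
      by (auto simp: vr_lists_def)
    then have h: "hd \<sigma> \<in> carrier G"
      using hd_in_carrier by blast
    note norm = normalize_vr_lists[OF G]
    have "homotopy (Suc n) \<sigma> = act (hd \<sigma>) (homotopy (Suc n) (normalize \<sigma>))"
      using homotopy_mult[of "Suc n" "normalize \<sigma>", OF _ _ h] n norm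
      by (simp add: map_hd_normalize[OF \<sigma>'(1)] del: homotopy.simps)
    then have "Poly_Mapping.keys (homotopy (Suc n) \<sigma>) \<subseteq> vr_lists (carrier G) d j (Suc (Suc n))"
      using keys_act_vr_lists[OF h rep[OF norm]] by simp
    with homotopy_keys[OF n \<sigma>]
    show "Poly_Mapping.keys (homotopy (Suc n) \<sigma>) \<subseteq> vr_lists (superlevel r) d j (Suc (Suc n))"
      unfolding vr_lists_def by blast
  qed
qed

section \<open>Filling cycles inside the half space\<close>

lemma homotopy_boundary_cycle:
  assumes n: "n \<le> m" and z: "Poly_Mapping.keys z \<subseteq> vr_lists (carrier G) d l (Suc n)" "vr_boundary z = 0"
  shows "vr_boundary (frag_extend (homotopy (Suc n)) z) = frag_extend (f (Suc n)) z - z"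
proof -
  have "vr_boundary (frag_extend (homotopy (Suc n)) z) =
      frag_extend (\<lambda>\<sigma>. f (Suc n) \<sigma> - frag_of \<sigma> - frag_extend (homotopy n) (vr_boundary (frag_of \<sigma>))) z"
    unfolding vr_boundary_extend
    by (rule frag_extend_eq) (use homotopy_boundary_simplex[OF n] z in blast)
  also have "\<dots> = frag_extend (f (Suc n)) z - z - frag_extend (homotopy n) (vr_boundary z)"
    unfolding frag_extend_vr_boundary[of _ z]
    by (induction z rule: frag_induction[OF subset_UNIV]) (auto simp: frag_extend_diff)
  finally show ?thesis
    by (simp add: z)
qed

text \<open>The scale j is fixed before c is given, as essential triviality demands. The number s of
  iterations does depend on c, but each iterate stays at scale l and each summand of the telescoped
  homotopy at scale \<open>j0\<close>, so s does not enter j.\<close>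

lemma halfspace_filling:
  assumes n: "n < m"
  obtains j where "l \<le> j"
    "\<And>c. Poly_Mapping.keys c \<subseteq> vr_lists (carrier G) d l (Suc (Suc n)) \<Longrightarrow>
      Poly_Mapping.keys (vr_boundary c) \<subseteq> vr_lists (superlevel 0) d l (Suc n) \<Longrightarrow>
      \<exists>b. Poly_Mapping.keys b \<subseteq> vr_lists (superlevel 0) d j (Suc (Suc n)) \<and> vr_boundary b = vr_boundary c"
proof -
  have n': "n \<le> m" "Suc n \<le> m"
    using n by auto
  let ?F = "\<lambda>n. frag_extend (f n)"
  obtain j0 where j0: "\<And>\<sigma> r. \<sigma> \<in> vr_lists (superlevel r) d l (Suc n) \<Longrightarrow>
      Poly_Mapping.keys (homotopy (Suc n) \<sigma>) \<subseteq> vr_lists (superlevel r) d j0 (Suc (Suc n))"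
    using homotopy_scale[OF n'(1)] by metis
  define j where "j = max l j0"
  have mono: "vr_lists X d l k \<subseteq> vr_lists X d j k" "vr_lists X d j0 k \<subseteq> vr_lists X d j k" for X k
    by (auto intro!: vr_lists_mono[OF subset_refl] simp: j_def)
  show ?thesis
  proof (rule that)
    show "l \<le> j"
      by (simp add: j_def)
    fix c assume c: "Poly_Mapping.keys c \<subseteq> vr_lists (carrier G) d l (Suc (Suc n))"
      and z: "Poly_Mapping.keys (vr_boundary c) \<subseteq> vr_lists (superlevel 0) d l (Suc n)"
    let ?z = "vr_boundary c"
    have iter_c: "Poly_Mapping.keys ((?F (Suc (Suc n)) ^^ s) c) \<subseteq> vr_lists (carrier G) d l (Suc (Suc n))" for s
    proof (induction s)
      case (Suc s)
      show ?case
        unfolding funpow.simps o_apply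
        by (rule keys_frag_extend_subset[OF Suc]) (use n' f_keys in blast)
    qed (use c in simp)
    have boundary_iter: "vr_boundary ((?F (Suc (Suc n)) ^^ s) c) = (?F (Suc n) ^^ s) ?z" for s
    proof (induction s)
      case (Suc s)
      then show ?case
        using extend_boundary[OF n'(2) iter_c[of s]] by simp
    qed simp
    have homologous: "\<exists>w. Poly_Mapping.keys w \<subseteq> vr_lists (superlevel 0) d j (Suc (Suc n)) \<and>
        vr_boundary w = (?F (Suc n) ^^ s) ?z - ?z" for s
    proof (induction s)
      case 0
      show ?case
        by (intro exI[of _ 0]) simp
    next
      case (Suc s)
      then obtain w where w: "Poly_Mapping.keys w \<subseteq> vr_lists (superlevel 0) d j (Suc (Suc n))"
        "vr_boundary w = (?F (Suc n) ^^ s) ?z - ?z"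
        by blast
      let ?y = "(?F (Suc n) ^^ s) ?z"
      have y: "Poly_Mapping.keys ?y \<subseteq> vr_lists (superlevel 0) d l (Suc n)"
        by (rule iterate_keys[OF n'(1) z])
      moreover have "vr_boundary ?y = 0"
        unfolding boundary_iter[symmetric] by simp
      \<comment> \<open>One link of the telescope: consecutive iterates of z differ by the boundary
        of a homotopy that remains in the half space.\<close>
      ultimately have "vr_boundary (frag_extend (homotopy (Suc n)) ?y) = ?F (Suc n) ?y - ?y"
        using vr_lists_superlevel_subset by (intro homotopy_boundary_cycle[OF n'(1)]) blast+
      with w(2) have "vr_boundary (w + frag_extend (homotopy (Suc n)) ?y) = (?F (Suc n) ^^ Suc s) ?z - ?z"
        by simp
      moreover have "Poly_Mapping.keys (frag_extend (homotopy (Suc n)) ?y) \<subseteq> vr_lists (superlevel 0) d j (Suc (Suc n))"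
        using order_trans[OF j0 mono(2)] by (rule keys_frag_extend_subset[OF y])
      with w(1) have "Poly_Mapping.keys (w + frag_extend (homotopy (Suc n)) ?y) \<subseteq> vr_lists (superlevel 0) d j (Suc (Suc n))"
        by (intro keys_add_subset)
      ultimately show ?case
        by blast
    qed
    obtain s where s: "Poly_Mapping.keys ((?F (Suc (Suc n)) ^^ s) c) \<subseteq> vr_lists (superlevel 0) d l (Suc (Suc n))"
      using iterate_into_halfspace[OF n'(2) c] by blast
    obtain w where w: "Poly_Mapping.keys w \<subseteq> vr_lists (superlevel 0) d j (Suc (Suc n))"
      "vr_boundary w = (?F (Suc n) ^^ s) ?z - ?z"
      using homologous by blast
    \<comment> \<open>The iterate of c bounds the iterate of z, and subtracting w replaces that
      iterate by z itself.\<close>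
    have "vr_boundary ((?F (Suc (Suc n)) ^^ s) c - w) = ?z"
      by (simp add: boundary_iter w)
    moreover have "Poly_Mapping.keys ((?F (Suc (Suc n)) ^^ s) c - w) \<subseteq> vr_lists (superlevel 0) d j (Suc (Suc n))"
      using s mono(1) w(1) by (intro keys_diff_subset) blast+
    ultimately show "\<exists>b. Poly_Mapping.keys b \<subseteq> vr_lists (superlevel 0) d j (Suc (Suc n)) \<and> vr_boundary b = ?z"
      by blast
  qed
qed

end

text \<open>A module endomorphism is prescribed on all chains, whereas the homotopy is built from
  values on simplices. The restriction to simplices is completed by the identity on the augmentation
  module, where \<open>extends_identity\<close> supplies the lowest boundary relation.\<close>

lemma (in metric_group_character) chain_endo_raising:
  assumes endo: "group_ring_chain_endo G d k m \<phi>" and ext: "extends_identity G d k \<phi>"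
    and raise: "\<And>q c. q \<le> m \<Longrightarrow> c \<in> carrier (vr_chains (carrier G) d k q) \<Longrightarrow> c \<noteq> 0 \<Longrightarrow>
      valuation \<chi> (\<phi> q c) - valuation \<chi> c > 0"
  shows "raising_chain_map G d \<chi>
    (\<lambda>n \<sigma>. case n of 0 \<Rightarrow> frag_of [] | Suc q \<Rightarrow> \<phi> q (frag_of \<sigma>)) k m"
proof -
  let ?C = "\<lambda>q. carrier (vr_chains (carrier G) d k q)"
  let ?f = "\<lambda>n \<sigma>. case n of 0 \<Rightarrow> frag_of [] | Suc q \<Rightarrow> \<phi> q (frag_of \<sigma>)"
  have closed: "\<phi> q c \<in> ?C q" if "q \<le> m" "c \<in> ?C q" for q c
    using endo that by (auto simp: group_ring_chain_endo_def hom_def)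
  have add: "\<phi> q (a + b) = \<phi> q a + \<phi> q b" if "q \<le> m" "a \<in> ?C q" "b \<in> ?C q" for q a b
    using endo that by (auto simp: group_ring_chain_endo_def hom_def vr_chains_def)
  have zero: "\<phi> q 0 = 0" if "q \<le> m" for q
    using add[OF that, of 0 0] by (simp add: carrier_vr_chains)
  have phi_diff: "\<phi> q (a - b) = \<phi> q a - \<phi> q b" if "q \<le> m" "a \<in> ?C q" "b \<in> ?C q" for q a b
  proof -
    have "a - b \<in> ?C q"
      using that keys_diff_subset unfolding carrier_vr_chains by blast
    from add[OF that(1) this that(3)] show ?thesis
      by simp
  qed
  have linear: "\<phi> q c = frag_extend (?f (Suc q)) c" if q: "q \<le> m" and c: "c \<in> ?C q" for q c
  proof -
    have "Poly_Mapping.keys c \<subseteq> vr_lists (carrier G) d k (Suc q)"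
      using c by (simp add: carrier_vr_chains)
    \<comment> \<open>Additivity of \<open>\<phi> q\<close> holds only on the carrier, so membership
      is carried through the induction.\<close>
    then have "c \<in> ?C q \<and> \<phi> q c = frag_extend (?f (Suc q)) c"
    proof (induction c rule: frag_induction)
      case (diff a b)
      then have "a - b \<in> ?C q"
        unfolding carrier_vr_chains by (intro keys_diff_subset) auto
      with diff show ?case
        using phi_diff[OF q, of a b]
        by (simp add: frag_extend_diff)
    qed (use zero[OF q] in \<open>auto simp: carrier_vr_chains\<close>)
    then show ?thesis
      by blast
  qed
  have simplex: "frag_of \<sigma> \<in> ?C q" if "\<sigma> \<in> vr_lists (carrier G) d k (Suc q)" for \<sigma> q
    using that by (simp add: carrier_vr_chains)
  have keys: "Poly_Mapping.keys (?f n \<sigma>) \<subseteq> vr_lists (carrier G) d k n"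
    if "n \<le> Suc m" "\<sigma> \<in> vr_lists (carrier G) d k n" for n \<sigma>
    using that closed simplex by (auto simp: carrier_vr_chains vr_lists_def split: nat.split)
  have mult: "?f n (map (\<lambda>x. g \<otimes> x) \<sigma>) = act g (?f n \<sigma>)"
    if "n \<le> Suc m" "\<sigma> \<in> vr_lists (carrier G) d k n" "g \<in> carrier G" for n \<sigma> g
  proof (cases n)
    case (Suc q)
    have "\<phi> q (group_ring_act G (frag_of g) (frag_of \<sigma>)) = group_ring_act G (frag_of g) (\<phi> q (frag_of \<sigma>))"
      using endo simplex[of \<sigma> q] that Suc by (simp add: group_ring_chain_endo_def)
    then show ?thesis
      by (simp add: group_ring_act_eq Suc)
  qed simp
  have boundary: "vr_boundary (?f (Suc n) \<sigma>) = frag_extend (?f n) (vr_boundary (frag_of \<sigma>))"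
    if n: "n \<le> m" and \<sigma>: "\<sigma> \<in> vr_lists (carrier G) d k (Suc n)" for n \<sigma>
  proof (cases n)
    case 0
    then obtain x where x: "\<sigma> = [x]"
      using \<sigma> by (auto simp: vr_lists_def length_Suc_conv)
    have "augmentation (\<phi> 0 (frag_of \<sigma>)) = 1"
      using ext simplex[of \<sigma> 0] \<sigma> 0 by (simp add: extends_identity_def augmentation_def)
    moreover have "Poly_Mapping.keys (\<phi> 0 (frag_of \<sigma>)) \<subseteq> vr_lists (carrier G) d k 1"
      using keys[of 1 \<sigma>] \<sigma> 0 by simp
    then have "vr_boundary (\<phi> 0 (frag_of \<sigma>)) = frag_cmul (augmentation (\<phi> 0 (frag_of \<sigma>))) (frag_of [])"
      by (intro vr_boundary_augmentation) (auto simp: vr_lists_def)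
    ultimately show ?thesis
      using 0 x by simp
  next
    case (Suc q)
    have "vr_boundary (\<phi> (Suc q) (frag_of \<sigma>)) = \<phi> q (vr_boundary (frag_of \<sigma>))"
      using endo simplex[of \<sigma> "Suc q"] n \<sigma> Suc by (simp add: group_ring_chain_endo_def)
    also have "\<dots> = frag_extend (?f (Suc q)) (vr_boundary (frag_of \<sigma>))"
      using n \<sigma> Suc
      by (intro linear) (auto simp: carrier_vr_chains dest!: subsetD[OF keys_vr_boundary_vr_lists, rotated])
    finally show ?thesis
      using Suc by simp
  qed
  have gain: "Min (\<chi> ` set \<sigma>) < \<chi> x"
    if n: "n \<le> m" and \<sigma>: "\<sigma> \<in> vr_lists (carrier G) d k (Suc n)"
      and \<tau>: "\<tau> \<in> Poly_Mapping.keys (?f (Suc n) \<sigma>)" "x \<in> set \<tau>" for n \<sigma> \<tau> x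
  proof -
    have "valuation \<chi> (frag_of \<sigma>) = ereal (Min (\<chi> ` set \<sigma>))"
      by (simp add: valuation_def)
    moreover have "0 < valuation \<chi> (\<phi> n (frag_of \<sigma>)) - valuation \<chi> (frag_of \<sigma>)"
      using raise[OF n simplex[OF \<sigma>]] by simp
    moreover have "valuation \<chi> (\<phi> n (frag_of \<sigma>)) \<le> ereal (\<chi> x)"
      using valuation_le[OF _ \<tau>(2)] \<tau>(1) by simp
    ultimately show ?thesis
      by (cases "valuation \<chi> (\<phi> n (frag_of \<sigma>))") auto
  qed
  show ?thesis
    using metric_group_character_axioms
    by (intro raising_chain_map.intro raising_chain_map_axioms.intro keys mult boundary gain) auto
qed

section \<open>The characterisation of the Sigma-invariants\<close>

theorem theorem2:
  fixes G :: "('a, 'b) monoid_scheme" and d :: "'a \<Rightarrow> 'a \<Rightarrow> real"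
    and m :: nat and \<chi> :: "'a \<Rightarrow> real"
  assumes "group G" and "group_metric G d"
    and "group_type_FP G d m"
    and "character G \<chi>" and "\<exists>g\<in>carrier G. \<chi> g \<noteq> 0"
  shows "\<chi> \<in> Sigma_inv G d m \<longleftrightarrow>
    (\<forall>\<^sub>F k in at_top. \<exists>\<phi>.
       group_ring_chain_endo G d k m \<phi> \<and> extends_identity G d k \<phi> \<and>
       (\<forall>q\<le>m. \<forall>c\<in>carrier (vr_chains (carrier G) d k q).
          c \<noteq> 0 \<longrightarrow> valuation \<chi> (\<phi> q c) - valuation \<chi> c > 0))"
    (is "_ \<longleftrightarrow> ?E")
proof -
  interpret proper_metric_group G d
    by (rule group_metric_imp_proper[OF assms(1,2)])
  interpret metric_group_character G d \<chi>
    using assms(4) by unfold_locales (auto simp: character_def hom_def)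
  have Sigma: "\<chi> \<in> Sigma_inv G d m \<longleftrightarrow> type_FP (superlevel 0) d m"
    using assms(4) by (simp add: Sigma_inv_def halfspace_eq)
  show ?thesis
    unfolding Sigma
  proof
    assume "type_FP (superlevel 0) d m"
    \<comment> \<open>The condition \<open>q < m\<close> stands inside the existential, so that the
      choice function J satisfies \<open>i \<le> J i q\<close> in every degree.\<close>
    then have "\<exists>j\<ge>i. q < m \<longrightarrow> (\<forall>z. Poly_Mapping.keys z \<subseteq> vr_lists (superlevel 0) d i (Suc q) \<longrightarrow>
        vr_boundary z = 0 \<longrightarrow>
        (\<exists>c. Poly_Mapping.keys c \<subseteq> vr_lists (superlevel 0) d j (Suc (Suc q)) \<and> vr_boundary c = z))"
      if "0 \<le> i" for i q
      using that by (cases "q < m") (auto simp: type_FP_def essentially_trivial_iff)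
    then obtain J where J: "\<And>i q. 0 \<le> i \<Longrightarrow> i \<le> J i q"
      "\<And>i q z. 0 \<le> i \<Longrightarrow> q < m \<Longrightarrow> Poly_Mapping.keys z \<subseteq> vr_lists (superlevel 0) d i (Suc q) \<Longrightarrow>
        vr_boundary z = 0 \<Longrightarrow>
        \<exists>c. Poly_Mapping.keys c \<subseteq> vr_lists (superlevel 0) d (J i q) (Suc (Suc q)) \<and> vr_boundary c = z"
      by metis
    \<comment> \<open>Images of vertices are single vertices, hence \<open>K 0 = 0\<close>; each
      further scale is where cycles of the previous one become boundaries in the half space.\<close>
    define K where "K = rec_nat 0 (\<lambda>q i. J i q)"
    have K: "K 0 = 0" "K (Suc q) = J (K q) q" for q
      by (simp_all add: K_def)
    have K_nonneg: "0 \<le> K q" for q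
    proof (induction q)
      case (Suc q)
      then show ?case
        using J(1)[of "K q" q] by (simp add: K)
    qed (simp add: K)
    obtain g where g: "g \<in> carrier G" "\<chi> g \<noteq> 0"
      using assms(5) by blast
    define t where "t = (if 0 < \<chi> g then g else inv\<^bsub>G\<^esub> g)"
    have t_in: "t \<in> carrier G" and t_pos: "0 < \<chi> t"
      using g by (auto simp: t_def)
    interpret filled_halfspace G d \<chi> t K m
      using t_in K_nonneg J by unfold_locales (auto simp: K)
    \<comment> \<open>The threshold for k is \<open>K m\<close>.\<close>
    show ?E
      unfolding eventually_at_top_linorder using raise_chain_endo t_pos by blast
  next
    assume ?E
    then obtain N where N: "\<And>k. N \<le> k \<Longrightarrow> \<exists>\<phi>.
       group_ring_chain_endo G d k m \<phi> \<and> extends_identity G d k \<phi> \<and>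
       (\<forall>q\<le>m. \<forall>c\<in>carrier (vr_chains (carrier G) d k q).
          c \<noteq> 0 \<longrightarrow> valuation \<chi> (\<phi> q c) - valuation \<chi> c > 0)"
      unfolding eventually_at_top_linorder by blast
    show "type_FP (superlevel 0) d m"
      unfolding type_FP_def essentially_trivial_iff
    proof (intro allI impI)
      fix q and i :: real assume q: "q < m" and "0 \<le> i"
      with assms(3) obtain l0 where l0: "i \<le> l0"
        "\<And>z. Poly_Mapping.keys z \<subseteq> vr_lists (carrier G) d i (Suc q) \<Longrightarrow> vr_boundary z = 0 \<Longrightarrow>
          \<exists>c. Poly_Mapping.keys c \<subseteq> vr_lists (carrier G) d l0 (Suc (Suc q)) \<and> vr_boundary c = z"
        unfolding group_type_FP_def type_FP_def essentially_trivial_iff by metis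
      \<comment> \<open>Large enough for the filling in G and for the existence of a
        valuation-raising endomorphism. The endomorphism depends on l, and so j is obtained only
        afterwards.\<close>
      define l where "l = max l0 N"
      obtain \<phi> where \<phi>: "group_ring_chain_endo G d l m \<phi>" "extends_identity G d l \<phi>"
        "\<And>q c. q \<le> m \<Longrightarrow> c \<in> carrier (vr_chains (carrier G) d l q) \<Longrightarrow> c \<noteq> 0 \<Longrightarrow>
          valuation \<chi> (\<phi> q c) - valuation \<chi> c > 0"
        using N[of l] by (auto simp: l_def)
      interpret raising_chain_map G d \<chi> "\<lambda>n \<sigma>. case n of 0 \<Rightarrow> frag_of [] | Suc q \<Rightarrow> \<phi> q (frag_of \<sigma>)" l m
        using \<phi> by (rule chain_endo_raising)
      obtain j where j: "l \<le> j"
        "\<And>c. Poly_Mapping.keys c \<subseteq> vr_lists (carrier G) d l (Suc (Suc q)) \<Longrightarrow>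
          Poly_Mapping.keys (vr_boundary c) \<subseteq> vr_lists (superlevel 0) d l (Suc q) \<Longrightarrow>
          \<exists>b. Poly_Mapping.keys b \<subseteq> vr_lists (superlevel 0) d j (Suc (Suc q)) \<and> vr_boundary b = vr_boundary c"
        using halfspace_filling[OF q] by metis
      have scales: "i \<le> l" "l0 \<le> l" "i \<le> j"
        using l0(1) j(1) by (auto simp: l_def)
      have "\<exists>b. Poly_Mapping.keys b \<subseteq> vr_lists (superlevel 0) d j (Suc (Suc q)) \<and> vr_boundary b = z"
        if z: "Poly_Mapping.keys z \<subseteq> vr_lists (superlevel 0) d i (Suc q)" "vr_boundary z = 0" for z
      proof -
        obtain c where c: "Poly_Mapping.keys c \<subseteq> vr_lists (carrier G) d l0 (Suc (Suc q))" "vr_boundary c = z"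
          using l0(2)[of z] z vr_lists_superlevel_subset by blast
        have "Poly_Mapping.keys c \<subseteq> vr_lists (carrier G) d l (Suc (Suc q))"
          using c(1) vr_lists_mono[OF subset_refl scales(2)] by blast
        moreover have "Poly_Mapping.keys (vr_boundary c) \<subseteq> vr_lists (superlevel 0) d l (Suc q)"
          using z(1) vr_lists_mono[OF subset_refl scales(1)] unfolding c(2) by blast
        ultimately show ?thesis
          using j(2) c(2) by blast
      qed
      with scales(3) show "\<exists>j\<ge>i. \<forall>z. Poly_Mapping.keys z \<subseteq> vr_lists (superlevel 0) d i (Suc q) \<longrightarrow>
          vr_boundary z = 0 \<longrightarrow>
          (\<exists>c. Poly_Mapping.keys c \<subseteq> vr_lists (superlevel 0) d j (Suc (Suc q)) \<and> vr_boundary c = z)"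
        by blast
    qed
  qed
qed

end
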